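(* Let $a>0$ and $y_0\in L^2(\mathbb{R})$. The heat Cauchy problem associated to the real harmonic oscillator $h^a_x=\frac{\partial^2}{\partial x^2}-a^2x^2$, $$\begin{cases} h^a_x y(t,x)=\frac{\partial}{\partial t}y(t,x), & (t,x)\in(0,\infty)\times\mathbb{R},\\ y(0,x)=y_0(x), & x\in\mathbb{R},\end{cases}$$ has the unique solution given by $$y(t,x)=\int_{\mathbb{R}}K_a(x,s,t)\,y_0(s)\,ds,$$ where $$K_a(x,s,t)=\sqrt{\frac a\pi}\,\left(e^{2at}-e^{-2at}\right)^{-\frac12}\exp\left\{-\frac{a\left(e^{at}x-e^{-at}s\right)^2}{e^{2at}-e^{-2at}}+\frac a2\left(x^2-s^2\right)\right\}.$$
   Formalization: "Solution" is taken to mean once continuously differentiable in t and twice in x for t>0, with y(t,·) continuous in L²(R) on t≥0 and y(0,x)=y₀(x) for almost every x; uniqueness is asserted in this class, since with no class specified it fails. *)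

theory Defs
  imports "HOL-Analysis.Analysis"
begin

definition square_integrable :: "(real \<Rightarrow> complex) \<Rightarrow> bool" where
  "square_integrable f \<longleftrightarrow>
     f \<in> borel_measurable lebesgue \<and> integrable lebesgue (\<lambda>x. (norm (f x))\<^sup>2)"

definition L2_continuous :: "(real \<Rightarrow> real \<Rightarrow> complex) \<Rightarrow> bool" where
  "L2_continuous y \<longleftrightarrow>
     (\<forall>t\<ge>0. square_integrable (y t)) \<and>
     (\<forall>t\<ge>0. ((\<lambda>\<tau>. \<integral>x. (norm (y \<tau> x - y t x))\<^sup>2 \<partial>lebesgue) \<longlongrightarrow> 0) (at t within {0..}))"

definition dt :: "(real \<Rightarrow> real \<Rightarrow> complex) \<Rightarrow> real \<Rightarrow> real \<Rightarrow> complex" where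
  "dt y t x = vector_derivative (\<lambda>\<tau>. y \<tau> x) (at t)"

definition dx :: "(real \<Rightarrow> complex) \<Rightarrow> real \<Rightarrow> complex" where
  "dx f x = vector_derivative f (at x)"

definition harmonic_oscillator :: "real \<Rightarrow> (real \<Rightarrow> complex) \<Rightarrow> real \<Rightarrow> complex" where
  "harmonic_oscillator a f x = dx (dx f) x - (a\<^sup>2 * x\<^sup>2) *\<^sub>R f x"

text \<open>Continuously differentiable once in time and twice in space on the open half plane
  \<open>t > 0\<close>. Differentiability is required explicitly, since \<^const>\<open>vector_derivative\<close> is total.\<close>

definition C12 :: "(real \<Rightarrow> real \<Rightarrow> complex) \<Rightarrow> bool" where
  "C12 y \<longleftrightarrow>
     (\<forall>t>0. \<forall>x. (\<lambda>\<tau>. y \<tau> x) differentiable (at t) \<and>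
                y t differentiable (at x) \<and> dx (y t) differentiable (at x)) \<and>
     continuous_on ({0<..} \<times> UNIV) (\<lambda>(t, x). y t x) \<and>
     continuous_on ({0<..} \<times> UNIV) (\<lambda>(t, x). dt y t x) \<and>
     continuous_on ({0<..} \<times> UNIV) (\<lambda>(t, x). dx (y t) x) \<and>
     continuous_on ({0<..} \<times> UNIV) (\<lambda>(t, x). dx (dx (y t)) x)"

text \<open>The equation holds classically for \<open>t > 0\<close>. The initial datum is an element of \<open>L\<^sup>2\<close>, hence
  only given almost everywhere, and it is attained through continuity of \<open>t \<mapsto> y t\<close> from
  \<open>[0, \<infinity>)\<close> to \<open>L\<^sup>2\<close>. Some such condition is needed: among all functions solving the equation
  pointwise there is no uniqueness (Tychonoff). The values of \<open>y\<close> at negative times are irrelevant.\<close>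

definition heat_solution ::
  "real \<Rightarrow> (real \<Rightarrow> complex) \<Rightarrow> (real \<Rightarrow> real \<Rightarrow> complex) \<Rightarrow> bool" where
  "heat_solution a y\<^sub>0 y \<longleftrightarrow>
     C12 y \<and> L2_continuous y \<and>
     (\<forall>t>0. \<forall>x. harmonic_oscillator a (y t) x = dt y t x) \<and>
     (AE x in lebesgue. y 0 x = y\<^sub>0 x)"

definition K :: "real \<Rightarrow> real \<Rightarrow> real \<Rightarrow> real \<Rightarrow> real" where
  "K a x s t =
     sqrt (a / pi) * (exp (2 * a * t) - exp (- 2 * a * t)) powr (- 1 / 2) *
     exp (- (a * (exp (a * t) * x - exp (- a * t) * s)\<^sup>2) / (exp (2 * a * t) - exp (- 2 * a * t))
          + a / 2 * (x\<^sup>2 - s\<^sup>2))"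

end

theory Submission
  imports Defs "HOL-Probability.Distributions"
begin

text \<open>
  In terms of \<open>A = a coth (2at)\<close> and \<open>B = a / sinh (2at)\<close> the kernel is the Mehler kernel
  \<open>sqrt (B / 2\<pi>) exp (B x s - A (x\<^sup>2 + s\<^sup>2) / 2)\<close> (lemma \<open>K_eq\<close>).

  \<^emph>\<open>The integral solves the equation.\<close> For \<open>t \<ge> t0 > 0\<close> the kernel lies below a fixed Gaussian in
  \<open>(x, s)\<close>, so all integrals \<open>\<integral> s\<^sup>k K y\<^sub>0\<close> converge and are continuous in \<open>(t, x)\<close>. The derivatives
  of \<open>K\<close> in \<open>x\<close> and \<open>t\<close> are polynomials in \<open>s\<close> times \<open>K\<close>; differentiation under the integral sign
  therefore expresses all derivatives of the solution by the moments \<open>k = 0, 1, 2\<close>, and the equation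
  reduces to \<open>A\<^sup>2 - B\<^sup>2 = a\<^sup>2\<close>.

  \<^emph>\<open>Continuity into \<open>L\<^sup>2\<close>.\<close> At positive times this is dominated convergence. For time \<open>0\<close>, write
  \<open>T\<^sub>t f = \<integral> K(\<cdot>, s, t) f(s) ds\<close>. The kernel is symmetric and equals a factor at most \<open>1\<close> times a
  normal density in \<open>s\<close>, whence \<open>\<parallel>T\<^sub>t f\<parallel> \<le> \<parallel>f\<parallel>\<close> (lemma \<open>L2sq_moment_le\<close>) and \<open>T\<^sub>t f \<rightarrow> f\<close> pointwise for
  bounded continuous \<open>f\<close>. If \<open>f\<close> is moreover integrable, then \<open>\<langle>T\<^sub>t f, f\<rangle> \<rightarrow> \<parallel>f\<parallel>\<^sup>2\<close> and
  \<open>\<parallel>T\<^sub>t f - f\<parallel>\<^sup>2 \<le> 2\<parallel>f\<parallel>\<^sup>2 - 2\<langle>T\<^sub>t f, f\<rangle> \<rightarrow> 0\<close>. Such \<open>f\<close> are dense (lemma \<open>L2_dense_continuous\<close>), and the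
  contraction property carries the limit over to all of \<open>L\<^sup>2\<close>.

  \<^emph>\<open>Uniqueness.\<close> The difference \<open>w\<close> of two solutions satisfies \<open>(|w|\<^sup>2)\<^sub>t \<le> (|w|\<^sup>2)\<^sub>x\<^sub>x\<close>. Nothing is known
  about the decay of \<open>w\<^sub>x\<close>, so this is tested against \<open>\<phi> = (1 - x\<^sup>2/R\<^sup>2)\<^sup>2\<close> on \<open>[-R, R]\<close> and both
  derivatives are moved onto \<open>\<phi>\<close>, where \<open>\<phi>'' \<le> 8/R\<^sup>2\<close> (lemma \<open>cutoff_energy_le\<close>). Since
  \<open>\<parallel>w(t)\<parallel>\<close> is bounded on \<open>[0, T]\<close>, letting \<open>t \<rightarrow> 0\<close> in the initial energy and then \<open>R \<rightarrow> \<infinity>\<close> gives \<open>w = 0\<close>.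
\<close>

section \<open>A localized energy estimate\<close>

text \<open>The weight vanishes to second order at \<open>\<plusminus>R\<close>, so no boundary terms appear when
  the two space derivatives are moved onto it.\<close>

lemma cutoff_energy_le:
  fixes w wt wx wxx :: "real \<Rightarrow> real \<Rightarrow> complex" and a R M \<epsilon> T :: real
  assumes R: "R > 0" and \<epsilon>: "0 < \<epsilon>" "\<epsilon> \<le> T"
    and dwt: "\<And>t x. t > 0 \<Longrightarrow> ((\<lambda>\<tau>. w \<tau> x) has_vector_derivative wt t x) (at t)"
    and dwx: "\<And>t x. t > 0 \<Longrightarrow> (w t has_vector_derivative wx t x) (at x)"
    and dwxx: "\<And>t x. t > 0 \<Longrightarrow> (wx t has_vector_derivative wxx t x) (at x)"
    and pde: "\<And>t x. t > 0 \<Longrightarrow> wxx t x - (a\<^sup>2 * x\<^sup>2) *\<^sub>R w t x = wt t x"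
    and cw: "continuous_on ({0<..} \<times> UNIV) (\<lambda>(t, x). w t x)"
    and cwt: "continuous_on ({0<..} \<times> UNIV) (\<lambda>(t, x). wt t x)"
    and cwx: "continuous_on ({0<..} \<times> UNIV) (\<lambda>(t, x). wx t x)"
    and cwxx: "continuous_on ({0<..} \<times> UNIV) (\<lambda>(t, x). wxx t x)"
    and M: "\<And>t. \<epsilon> \<le> t \<Longrightarrow> t \<le> T \<Longrightarrow> integral {-R..R} (\<lambda>x. (norm (w t x))\<^sup>2) \<le> M"
  shows "integral {-R..R} (\<lambda>x. (1 - x\<^sup>2 / R\<^sup>2)\<^sup>2 * (norm (w T x))\<^sup>2)
    \<le> integral {-R..R} (\<lambda>x. (1 - x\<^sup>2 / R\<^sup>2)\<^sup>2 * (norm (w \<epsilon> x))\<^sup>2) + 8 / R\<^sup>2 * M * (T - \<epsilon>)"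
proof -
  define \<phi> where "\<phi> x = (1 - x\<^sup>2 / R\<^sup>2)\<^sup>2" for x
  define \<phi>1 where "\<phi>1 x = 2 * (1 - x\<^sup>2 / R\<^sup>2) * (- 2 * x / R\<^sup>2)" for x
  define \<phi>2 where "\<phi>2 x = (12 * x\<^sup>2 / R\<^sup>2 - 4) / R\<^sup>2" for x
  define E where "E t = integral (cbox (-R) R) (\<lambda>x. \<phi> x * (w t x \<bullet> w t x))" for t
  define E' where "E' t = integral (cbox (-R) R) (\<lambda>x. \<phi> x * (2 * (w t x \<bullet> wt t x)))" for t
  note [continuous_intros] =
    continuous_on_compose2[OF cw, where f="\<lambda>y. (t, y)" for t, unfolded split_beta fst_conv snd_conv]
    continuous_on_compose2[OF cwt, where f="\<lambda>y. (t, y)" for t, unfolded split_beta fst_conv snd_conv]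
    continuous_on_compose2[OF cwx, where f="\<lambda>y. (t, y)" for t, unfolded split_beta fst_conv snd_conv]
    continuous_on_compose2[OF cwxx, where f="\<lambda>y. (t, y)" for t, unfolded split_beta fst_conv snd_conv]
  have d\<phi>: "(\<phi> has_real_derivative \<phi>1 x) (at x)" for x
    unfolding \<phi>_def \<phi>1_def using R by (auto intro!: derivative_eq_intros simp: field_simps)
  have d\<phi>1: "(\<phi>1 has_real_derivative \<phi>2 x) (at x)" for x
    unfolding \<phi>1_def \<phi>2_def using R
    by (auto intro!: derivative_eq_intros simp: field_simps power2_eq_square)
  have cont: "continuous_on S \<phi>" "continuous_on S \<phi>1" "continuous_on S \<phi>2" for S
    unfolding \<phi>_def \<phi>1_def \<phi>2_def using R by (auto intro!: continuous_intros)
  have \<phi>0: "\<phi> x \<ge> 0" for x by (simp add: \<phi>_def)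
  have \<phi>2b: "\<phi>2 x \<le> 8 / R\<^sup>2" if "x \<in> {-R..R}" for x
  proof -
    have "x\<^sup>2 \<le> R\<^sup>2" using that R by (intro power2_le_iff_abs_le[THEN iffD2]) auto
    then show ?thesis unfolding \<phi>2_def using R by (intro divide_right_mono) (auto simp: field_simps)
  qed
  have dE: "(E has_real_derivative E' t) (at t)" if "t > 0" for t
  proof -
    have "(E has_vector_derivative E' t) (at t within {0<..})"
      unfolding E_def E'_def
    proof (rule leibniz_rule_vector_derivative)
      fix \<tau> x :: real assume "\<tau> \<in> {0<..}"
      then have "((\<lambda>\<tau>. w \<tau> x) has_vector_derivative wt \<tau> x) (at \<tau>)" using dwt by auto
      then have "((\<lambda>\<tau>. w \<tau> x \<bullet> w \<tau> x) has_vector_derivative w \<tau> x \<bullet> wt \<tau> x + wt \<tau> x \<bullet> w \<tau> x) (at \<tau>)"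
        by (intro bounded_bilinear.has_vector_derivative[OF bounded_bilinear_inner])
      then have "((\<lambda>\<tau>. \<phi> x * (w \<tau> x \<bullet> w \<tau> x)) has_vector_derivative
          \<phi> x * (w \<tau> x \<bullet> wt \<tau> x + wt \<tau> x \<bullet> w \<tau> x)) (at \<tau>)"
        by (rule has_vector_derivative_mult_right)
      moreover have "w \<tau> x \<bullet> wt \<tau> x + wt \<tau> x \<bullet> w \<tau> x = 2 * (w \<tau> x \<bullet> wt \<tau> x)"
        by (simp add: inner_commute)
      ultimately show "((\<lambda>\<tau>. \<phi> x * (w \<tau> x \<bullet> w \<tau> x)) has_vector_derivative
          \<phi> x * (2 * (w \<tau> x \<bullet> wt \<tau> x))) (at \<tau> within {0<..})"
        by (auto intro: has_vector_derivative_at_within)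
    next
      fix \<tau> :: real assume "\<tau> \<in> {0<..}"
      then show "(\<lambda>x. \<phi> x * (w \<tau> x \<bullet> w \<tau> x)) integrable_on cbox (-R) R"
        by (intro integrable_continuous continuous_intros cont) auto
    next
      have "continuous_on ({0<..} \<times> cbox (-R) R) (\<lambda>(t, x). w t x)"
        "continuous_on ({0<..} \<times> cbox (-R) R) (\<lambda>(t, x). wt t x)"
        using cw cwt by (auto elim!: continuous_on_subset)
      then show "continuous_on ({0<..} \<times> cbox (-R) R) (\<lambda>(\<tau>, x). \<phi> x * (2 * (w \<tau> x \<bullet> wt \<tau> x)))"
        by (auto simp: split_beta intro!: continuous_intros continuous_on_compose2[OF cont(1)[of UNIV]])
    qed (use that in auto)
    then show ?thesis
      using that at_within_open[of t "{0<..}"]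
      by (simp add: has_real_derivative_iff_has_vector_derivative)
  qed
  have E'b: "E' t \<le> 8 / R\<^sup>2 * M" if t: "\<epsilon> \<le> t" "t \<le> T" for t
  proof -
    have t0: "t > 0" using t \<epsilon> by auto
    define v where "v x = w t x \<bullet> w t x" for x
    define v1 where "v1 x = 2 * (w t x \<bullet> wx t x)" for x
    define v2 where "v2 x = 2 * (w t x \<bullet> wxx t x) + 2 * (wx t x \<bullet> wx t x)" for x
    have dv: "(v has_real_derivative v1 x) (at x)" for x
      using bounded_bilinear.has_vector_derivative[OF bounded_bilinear_inner dwx[OF t0] dwx[OF t0], of x]
      by (simp add: has_real_derivative_iff_has_vector_derivative v_def[abs_def] v1_def inner_commute)
    have dv1: "(v1 has_real_derivative v2 x) (at x)" for x
      using has_vector_derivative_mult_right[OF bounded_bilinear.has_vector_derivative[OF bounded_bilinear_inner dwx[OF t0] dwxx[OF t0], of x], of 2]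
      by (simp add: has_real_derivative_iff_has_vector_derivative v1_def[abs_def] v2_def inner_commute)
    have cv: "continuous_on S v" "continuous_on S v1" "continuous_on S v2" for S
      unfolding v_def v1_def v2_def using t0 by (auto intro!: continuous_intros)
    \<comment> \<open>Integration by parts, as \<open>\<phi> v'' - \<phi>'' v = (\<phi> v' - \<phi>' v)'\<close>.\<close>
    have "((\<lambda>x. \<phi> x * v2 x - \<phi>2 x * v x) has_integral
        (\<phi> R * v1 R - \<phi>1 R * v R) - (\<phi> (-R) * v1 (-R) - \<phi>1 (-R) * v (-R))) {-R..R}"
    proof (rule fundamental_theorem_of_calculus)
      fix x
      have "((\<lambda>x. \<phi> x * v1 x - \<phi>1 x * v x) has_real_derivative
         (\<phi>1 x * v1 x + v2 x * \<phi> x) - (\<phi>2 x * v x + v1 x * \<phi>1 x)) (at x)"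
        by (intro derivative_intros d\<phi> d\<phi>1 dv dv1)
      moreover have "(\<phi>1 x * v1 x + v2 x * \<phi> x) - (\<phi>2 x * v x + v1 x * \<phi>1 x) = \<phi> x * v2 x - \<phi>2 x * v x"
        by (simp add: algebra_simps)
      ultimately show "((\<lambda>x. \<phi> x * v1 x - \<phi>1 x * v x) has_vector_derivative \<phi> x * v2 x - \<phi>2 x * v x)
          (at x within {-R..R})"
        by (metis has_real_derivative_iff_has_vector_derivative has_vector_derivative_at_within)
    qed (use R in auto)
    moreover have "\<phi> R = 0" "\<phi> (-R) = 0" "\<phi>1 R = 0" "\<phi>1 (-R) = 0"
      using R by (auto simp: \<phi>_def \<phi>1_def)
    ultimately have "((\<lambda>x. \<phi> x * v2 x - \<phi>2 x * v x) has_integral 0) {-R..R}" by simp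
    then have "integral {-R..R} (\<lambda>x. \<phi> x * v2 x - \<phi>2 x * v x) = 0" by (rule integral_unique)
    then have ibp: "integral {-R..R} (\<lambda>x. \<phi> x * v2 x) = integral {-R..R} (\<lambda>x. \<phi>2 x * v x)"
      by (subst (asm) integral_diff) (auto intro!: integrable_continuous_real continuous_intros cont cv)
    have "E' t \<le> integral {-R..R} (\<lambda>x. \<phi> x * v2 x)"
      unfolding E'_def cbox_interval
    proof (rule integral_le)
      show "(\<lambda>x. \<phi> x * (2 * (w t x \<bullet> wt t x))) integrable_on {- R..R}"
        using t0 by (auto intro!: integrable_continuous_real continuous_intros cont)
      show "(\<lambda>x. \<phi> x * v2 x) integrable_on {- R..R}"
        by (auto intro!: integrable_continuous_real continuous_intros cont cv)
      fix x
      have "2 * (w t x \<bullet> wt t x) = 2 * (w t x \<bullet> wxx t x) - 2 * (a\<^sup>2 * x\<^sup>2 * (w t x \<bullet> w t x))"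
        by (simp add: pde[OF t0, symmetric] inner_diff_right)
      also have "\<dots> \<le> v2 x" unfolding v2_def by (simp add: add_increasing2 add.commute)
      finally show "\<phi> x * (2 * (w t x \<bullet> wt t x)) \<le> \<phi> x * v2 x"
        by (intro mult_left_mono \<phi>0)
    qed
    also have "\<dots> = integral {-R..R} (\<lambda>x. \<phi>2 x * v x)" by (rule ibp)
    also have "\<dots> \<le> integral {-R..R} (\<lambda>x. 8 / R\<^sup>2 * v x)"
      by (intro integral_le mult_right_mono \<phi>2b integrable_continuous_real continuous_intros cont cv)
        (auto simp: v_def)
    also have "\<dots> = 8 / R\<^sup>2 * integral {-R..R} (\<lambda>x. (norm (w t x))\<^sup>2)"
      by (simp add: v_def power2_norm_eq_inner)
    also have "\<dots> \<le> 8 / R\<^sup>2 * M" by (intro mult_left_mono M t) auto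
    finally show ?thesis .
  qed
  have "E T - E \<epsilon> \<le> 8 / R\<^sup>2 * M * (T - \<epsilon>)"
  proof (cases "\<epsilon> = T")
    case False
    then have "\<epsilon> < T" using \<epsilon> by auto
    then obtain z where z: "z > \<epsilon>" "z < T" "E T - E \<epsilon> = (T - \<epsilon>) * E' z"
      using MVT2[of \<epsilon> T E E'] dE \<epsilon> by force
    have "E' z \<le> 8 / R\<^sup>2 * M" using E'b z by simp
    from mult_right_mono[OF this, of "T - \<epsilon>"] show ?thesis
      using z(3) \<open>\<epsilon> < T\<close> by (simp add: mult.commute)
  qed simp
  then show ?thesis by (simp add: E_def \<phi>_def power2_norm_eq_inner algebra_simps)
qed

section \<open>Mean squares\<close>

text \<open>The square of the \<open>L\<^sup>2\<close> norm.\<close>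

definition L2sq :: "(real \<Rightarrow> complex) \<Rightarrow> real" where
  "L2sq f = (\<integral>x. (norm (f x))\<^sup>2 \<partial>lebesgue)"

lemma L2sq_nonneg: "0 \<le> L2sq f"
  by (simp add: L2sq_def)

lemma norm_add_sq_le:
  fixes p q :: "'a::real_normed_vector"
  shows "(norm (p + q))\<^sup>2 \<le> 2 * (norm p)\<^sup>2 + 2 * (norm q)\<^sup>2"
proof -
  have "(norm (p + q))\<^sup>2 \<le> (norm p + norm q)\<^sup>2"
    by (intro power_mono norm_triangle_ineq) auto
  also have "\<dots> \<le> 2 * (norm p)\<^sup>2 + 2 * (norm q)\<^sup>2"
    using zero_le_power2[of "norm p - norm q"] by (simp add: power2_eq_square algebra_simps)
  finally show ?thesis .
qed

lemma square_integrable_measurable: "square_integrable f \<Longrightarrow> f \<in> borel_measurable lebesgue"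
  by (simp add: square_integrable_def)

lemma square_integrable_bound:
  assumes "f \<in> borel_measurable lebesgue" "integrable lebesgue g" "\<And>x. (norm (f x))\<^sup>2 \<le> g x"
  shows "square_integrable f"
  unfolding square_integrable_def
proof
  have [measurable]: "f \<in> borel_measurable lebesgue" by fact
  show "integrable lebesgue (\<lambda>x. (norm (f x))\<^sup>2)"
    by (rule Bochner_Integration.integrable_bound[OF assms(2)])
      (use assms(3) in \<open>auto intro: order_trans[OF _ abs_ge_self]\<close>)
qed fact

lemma square_integrable_add:
  assumes "square_integrable f" "square_integrable g"
  shows "square_integrable (\<lambda>x. f x + g x)"
  by (rule square_integrable_bound[where g = "\<lambda>x. 2 * (norm (f x))\<^sup>2 + 2 * (norm (g x))\<^sup>2"])
    (use assms norm_add_sq_le in \<open>auto simp: square_integrable_def\<close>)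

lemma L2sq_add_le:
  assumes "square_integrable f" "square_integrable g"
  shows "L2sq (\<lambda>x. f x + g x) \<le> 2 * L2sq f + 2 * L2sq g"
proof -
  have "L2sq (\<lambda>x. f x + g x) \<le> (\<integral>x. 2 * (norm (f x))\<^sup>2 + 2 * (norm (g x))\<^sup>2 \<partial>lebesgue)"
    unfolding L2sq_def using assms square_integrable_add[OF assms] norm_add_sq_le
    by (intro integral_mono) (auto simp: square_integrable_def)
  also have "\<dots> = 2 * L2sq f + 2 * L2sq g"
    using assms by (simp add: L2sq_def square_integrable_def)
  finally show ?thesis .
qed

lemma square_integrable_uminus: "square_integrable (\<lambda>x. - f x) \<longleftrightarrow> square_integrable f"
proof -
  have "f \<in> borel_measurable lebesgue" if "(\<lambda>x. - f x) \<in> borel_measurable lebesgue"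
    using borel_measurable_uminus[OF that] by simp
  then show ?thesis by (auto simp: square_integrable_def)
qed

lemma square_integrable_diff:
  assumes "square_integrable f" "square_integrable g"
  shows "square_integrable (\<lambda>x. f x - g x)"
  using square_integrable_add[of f "\<lambda>x. - g x"] assms by (simp add: square_integrable_uminus)

lemma L2sq_diff_le:
  assumes "square_integrable f" "square_integrable g"
  shows "L2sq (\<lambda>x. f x - g x) \<le> 2 * L2sq f + 2 * L2sq g"
  using L2sq_add_le[of f "\<lambda>x. - g x"] assms by (simp add: square_integrable_uminus L2sq_def)

lemma L2_continuous_diff:
  assumes "L2_continuous y" "L2_continuous z"
  shows "L2_continuous (\<lambda>t x. y t x - z t x)"
  unfolding L2_continuous_def L2sq_def[symmetric]
proof (intro conjI allI impI)
  fix t :: real assume t: "0 \<le> t"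
  have sq: "square_integrable (y \<tau>)" "square_integrable (z \<tau>)" if "\<tau> \<ge> 0" for \<tau>
    using assms that by (auto simp: L2_continuous_def)
  show "square_integrable (\<lambda>x. y t x - z t x)"
    using sq t by (intro square_integrable_diff) auto
  have "((\<lambda>\<tau>. 2 * L2sq (\<lambda>x. y \<tau> x - y t x) + 2 * L2sq (\<lambda>x. z \<tau> x - z t x))
      \<longlongrightarrow> 2 * 0 + 2 * 0) (at t within {0..})"
    using assms t by (intro tendsto_intros) (auto simp: L2_continuous_def L2sq_def)
  then have lim: "((\<lambda>\<tau>. 2 * L2sq (\<lambda>x. y \<tau> x - y t x) + 2 * L2sq (\<lambda>x. z \<tau> x - z t x))
      \<longlongrightarrow> 0) (at t within {0..})" by simp
  show "((\<lambda>\<tau>. L2sq (\<lambda>x. y \<tau> x - z \<tau> x - (y t x - z t x))) \<longlongrightarrow> 0) (at t within {0..})"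
  proof (rule tendsto_sandwich[OF _ _ tendsto_const lim])
    show "\<forall>\<^sub>F \<tau> in at t within {0..}. L2sq (\<lambda>x. y \<tau> x - z \<tau> x - (y t x - z t x))
        \<le> 2 * L2sq (\<lambda>x. y \<tau> x - y t x) + 2 * L2sq (\<lambda>x. z \<tau> x - z t x)"
      unfolding eventually_at_filter
    proof (intro always_eventually allI impI)
      fix \<tau> :: real assume "\<tau> \<in> {0..}"
      then have "L2sq (\<lambda>x. (y \<tau> x - y t x) - (z \<tau> x - z t x))
          \<le> 2 * L2sq (\<lambda>x. y \<tau> x - y t x) + 2 * L2sq (\<lambda>x. z \<tau> x - z t x)"
        using t by (intro L2sq_diff_le square_integrable_diff sq) auto
      then show "L2sq (\<lambda>x. y \<tau> x - z \<tau> x - (y t x - z t x))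
        \<le> 2 * L2sq (\<lambda>x. y \<tau> x - y t x) + 2 * L2sq (\<lambda>x. z \<tau> x - z t x)"
        by (simp add: algebra_simps)
    qed
  qed (simp add: L2sq_nonneg)
qed

lemma L2_continuous_bounded:
  assumes "L2_continuous w" "0 \<le> T"
  shows "\<exists>M. \<forall>t\<in>{0..T}. L2sq (w t) \<le> M"
proof -
  have sq: "square_integrable (w \<tau>)" if "\<tau> \<ge> 0" for \<tau>
    using assms that by (auto simp: L2_continuous_def)
  define P where "P a b \<longleftrightarrow> (\<exists>M. \<forall>t\<in>{a..b}. 0 \<le> t \<longrightarrow> L2sq (w t) \<le> M)" for a b
  have "P 0 T"
    using \<open>0 \<le> T\<close>
  proof (induction rule: Bolzano)
    case (trans a b c)
    then obtain M1 M2 where "\<forall>t\<in>{a..b}. 0 \<le> t \<longrightarrow> L2sq (w t) \<le> M1" "\<forall>t\<in>{b..c}. 0 \<le> t \<longrightarrow> L2sq (w t) \<le> M2"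
      unfolding P_def by blast
    then show ?case unfolding P_def by (intro exI[of _ "max M1 M2"]) (force simp: le_max_iff_disj)
  next
    case (local t)
    have "((\<lambda>\<tau>. L2sq (\<lambda>x. w \<tau> x - w t x)) \<longlongrightarrow> 0) (at t within {0..})"
      using assms local by (auto simp: L2_continuous_def L2sq_def)
    then have "\<forall>\<^sub>F \<tau> in at t within {0..}. L2sq (\<lambda>x. w \<tau> x - w t x) < 1"
      by (rule order_tendstoD) simp
    then obtain d where d: "d > 0" "\<And>\<tau>. \<tau> \<ge> 0 \<Longrightarrow> \<tau> \<noteq> t \<Longrightarrow> dist \<tau> t < d \<Longrightarrow> L2sq (\<lambda>x. w \<tau> x - w t x) < 1"
      unfolding eventually_at by auto
    have bd: "L2sq (w \<tau>) \<le> 2 + 2 * L2sq (w t)" if "\<tau> \<ge> 0" "dist \<tau> t < d" for \<tau>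
    proof (cases "\<tau> = t")
      case True
      then show ?thesis using L2sq_nonneg[of "w t"] by simp
    next
      case False
      have "L2sq (\<lambda>x. (w \<tau> x - w t x) + w t x) \<le> 2 * L2sq (\<lambda>x. w \<tau> x - w t x) + 2 * L2sq (w t)"
        using that local by (intro L2sq_add_le square_integrable_diff sq) auto
      then show ?thesis using d(2)[OF that(1) False that(2)] by simp
    qed
    show ?case
    proof (intro exI conjI allI impI)
      fix a b assume "a \<le> t \<and> t \<le> b \<and> b - a < d"
      then show "P a b" unfolding P_def
        by (intro exI[of _ "2 + 2 * L2sq (w t)"] ballI impI bd) (auto simp: dist_real_def)
    qed (use d in auto)
  qed
  then show ?thesis by (auto simp: P_def)
qed

lemma integral_interval_le_L2sq:
  assumes "square_integrable f" "continuous_on UNIV f"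
  shows "integral {a..b} (\<lambda>x. (norm (f x))\<^sup>2) \<le> L2sq f"
proof -
  have int: "integrable lebesgue (\<lambda>x. (norm (f x))\<^sup>2)"
    using assms by (auto simp: square_integrable_def)
  have "L2sq f = integral UNIV (\<lambda>x. (norm (f x))\<^sup>2)"
    unfolding L2sq_def by (rule integral_lebesgue[OF int, symmetric])
  moreover have "integral {a..b} (\<lambda>x. (norm (f x))\<^sup>2) \<le> integral UNIV (\<lambda>x. (norm (f x))\<^sup>2)"
    using assms(2) by (intro integral_subset_le integrable_on_lebesgue[OF int] integrable_continuous_real
        continuous_intros) (auto elim: continuous_on_subset)
  ultimately show ?thesis by simp
qed

section \<open>Uniqueness\<close>

lemma heat_solution_unique:
  assumes y: "heat_solution a y\<^sub>0 y" and z: "heat_solution a y\<^sub>0 z" and T: "T > 0"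
  shows "y T x = z T x"
proof -
  define w where "w t x = y t x - z t x" for t x
  define wt where "wt t x = dt y t x - dt z t x" for t x
  define wx where "wx t x = dx (y t) x - dx (z t) x" for t x
  define wxx where "wxx t x = dx (dx (y t)) x - dx (dx (z t)) x" for t x
  have C: "C12 y" "C12 z" using y z by (auto simp: heat_solution_def)
  have dwt: "((\<lambda>\<tau>. w \<tau> x) has_vector_derivative wt t x) (at t)" if "t > 0" for t x
    using C that unfolding w_def wt_def dt_def C12_def
    by (intro has_vector_derivative_diff) (auto simp: vector_derivative_works)
  have dwx: "(w t has_vector_derivative wx t x) (at x)" if "t > 0" for t x
    using C that unfolding w_def[abs_def] wx_def dx_def C12_def
    by (intro has_vector_derivative_diff) (auto simp: vector_derivative_works[symmetric])
  have dwxx: "(wx t has_vector_derivative wxx t x) (at x)" if "t > 0" for t x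
  proof -
    have "(dx (y t) has_vector_derivative dx (dx (y t)) x) (at x)" 
      "(dx (z t) has_vector_derivative dx (dx (z t)) x) (at x)"
      using C that unfolding C12_def by (auto simp: dx_def[of "dx _"] vector_derivative_works[symmetric])
    then show ?thesis unfolding wx_def[abs_def] wxx_def by (rule has_vector_derivative_diff)
  qed
  have pde: "wxx t x - (a\<^sup>2 * x\<^sup>2) *\<^sub>R w t x = wt t x" if "t > 0" for t x
  proof -
    have "harmonic_oscillator a (y t) x = dt y t x" "harmonic_oscillator a (z t) x = dt z t x"
      using y z that by (auto simp: heat_solution_def)
    then show ?thesis
      by (simp add: w_def wt_def wxx_def harmonic_oscillator_def algebra_simps flip: \<open>_ = dt y t x\<close> \<open>_ = dt z t x\<close>)
  qed
  have cw: "continuous_on ({0<..} \<times> UNIV) (\<lambda>(t, x). w t x)"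
    and cwt: "continuous_on ({0<..} \<times> UNIV) (\<lambda>(t, x). wt t x)"
    and cwx: "continuous_on ({0<..} \<times> UNIV) (\<lambda>(t, x). wx t x)"
    and cwxx: "continuous_on ({0<..} \<times> UNIV) (\<lambda>(t, x). wxx t x)"
    using C unfolding C12_def w_def wt_def wx_def wxx_def split_beta by (auto intro: continuous_on_diff)
  have L2: "L2_continuous w"
    unfolding w_def[abs_def] using y z by (intro L2_continuous_diff) (auto simp: heat_solution_def)
  then have sq: "square_integrable (w t)" if "t \<ge> 0" for t
    using that by (auto simp: L2_continuous_def)
  obtain M where "\<forall>t\<in>{0..T}. L2sq (w t) \<le> M"
    using L2_continuous_bounded[OF L2, of T] T by auto
  then have M: "L2sq (w t) \<le> M" if "t \<in> {0..T}" for t using that by auto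
  have M0: "0 \<le> M" using M[of T] L2sq_nonneg[of "w T"] T by auto
  have cont: "continuous_on S (w t)" if "t > 0" for t S
    using that by (intro continuous_on_compose2[OF cw, where f="\<lambda>y. (t, y)", unfolded split_beta fst_conv snd_conv])
      (auto intro!: continuous_intros)
  have lim0: "((\<lambda>\<epsilon>. L2sq (w \<epsilon>)) \<longlongrightarrow> 0) (at_right 0)"
  proof -
    have "AE x in lebesgue. w 0 x = 0"
      using y z unfolding heat_solution_def w_def by auto
    then have ae: "AE x in lebesgue. (norm (w \<tau> x - w 0 x))\<^sup>2 = (norm (w \<tau> x))\<^sup>2" for \<tau> by auto
    have "L2sq (\<lambda>x. w \<tau> x - w 0 x) = L2sq (w \<tau>)" if "\<tau> \<ge> 0" for \<tau>
      unfolding L2sq_def using sq[OF that] square_integrable_diff[OF sq[OF that] sq[of 0]]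
      by (intro integral_cong_AE ae) (auto simp: square_integrable_def)
    moreover have "((\<lambda>\<tau>. L2sq (\<lambda>x. w \<tau> x - w 0 x)) \<longlongrightarrow> 0) (at 0 within {0..})"
      using L2 by (auto simp: L2_continuous_def L2sq_def)
    then have "((\<lambda>\<tau>. L2sq (\<lambda>x. w \<tau> x - w 0 x)) \<longlongrightarrow> 0) (at_right 0)"
      by (rule tendsto_within_subset) auto
    ultimately show ?thesis
      by (elim Lim_transform_eventually) (auto simp: eventually_at_filter)
  qed
  have main: "integral {-R..R} (\<lambda>x. (1 - x\<^sup>2 / R\<^sup>2)\<^sup>2 * (norm (w T x))\<^sup>2) \<le> 8 / R\<^sup>2 * M * T" if R: "R > 0" for R
  proof (rule tendsto_lowerbound)
    show "((\<lambda>\<epsilon>. L2sq (w \<epsilon>) + 8 / R\<^sup>2 * M * (T - \<epsilon>)) \<longlongrightarrow> 8 / R\<^sup>2 * M * T) (at_right 0)"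
      by (rule tendsto_eq_intros lim0 | simp)+
    have "integral {-R..R} (\<lambda>x. (1 - x\<^sup>2 / R\<^sup>2)\<^sup>2 * (norm (w T x))\<^sup>2) \<le> L2sq (w \<epsilon>) + 8 / R\<^sup>2 * M * (T - \<epsilon>)"
      if e: "0 < \<epsilon>" "\<epsilon> < T" for \<epsilon>
    proof -
      have "integral {-R..R} (\<lambda>x. (1 - x\<^sup>2 / R\<^sup>2)\<^sup>2 * (norm (w T x))\<^sup>2)
        \<le> integral {-R..R} (\<lambda>x. (1 - x\<^sup>2 / R\<^sup>2)\<^sup>2 * (norm (w \<epsilon> x))\<^sup>2) + 8 / R\<^sup>2 * M * (T - \<epsilon>)"
      proof (rule cutoff_energy_le[OF R _ _ dwt dwx dwxx pde cw cwt cwx cwxx])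
        fix t assume t: "\<epsilon> \<le> t" "t \<le> T"
        then have "integral {-R..R} (\<lambda>x. (norm (w t x))\<^sup>2) \<le> L2sq (w t)"
          using e by (intro integral_interval_le_L2sq sq cont) auto
        also have "\<dots> \<le> M" using M t e by auto
        finally show "integral {-R..R} (\<lambda>x. (norm (w t x))\<^sup>2) \<le> M" .
      qed (use e in auto)
      also have "integral {-R..R} (\<lambda>x. (1 - x\<^sup>2 / R\<^sup>2)\<^sup>2 * (norm (w \<epsilon> x))\<^sup>2)
          \<le> integral {-R..R} (\<lambda>x. (norm (w \<epsilon> x))\<^sup>2)"
      proof (rule integral_le)
        fix x assume "x \<in> {-R..R}"
        then have "x\<^sup>2 \<le> R\<^sup>2" using R by (intro power2_le_iff_abs_le[THEN iffD2]) auto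
        then have "(1 - x\<^sup>2 / R\<^sup>2)\<^sup>2 \<le> 1\<^sup>2" using R by (intro power_mono) (auto simp: field_simps)
        then show "(1 - x\<^sup>2 / R\<^sup>2)\<^sup>2 * (norm (w \<epsilon> x))\<^sup>2 \<le> (norm (w \<epsilon> x))\<^sup>2"
          by (intro mult_left_le_one_le) auto
      qed (use e R cont in \<open>auto intro!: integrable_continuous_real continuous_intros\<close>)
      also have "\<dots> \<le> L2sq (w \<epsilon>)" using e by (intro integral_interval_le_L2sq sq cont) auto
      finally show ?thesis by simp
    qed
    then show "\<forall>\<^sub>F \<epsilon> in at_right 0. integral {-R..R} (\<lambda>x. (1 - x\<^sup>2 / R\<^sup>2)\<^sup>2 * (norm (w T x))\<^sup>2)
        \<le> L2sq (w \<epsilon>) + 8 / R\<^sup>2 * M * (T - \<epsilon>)"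
      using T by (auto simp: eventually_at_right)
  qed simp
  \<comment> \<open>On a fixed interval \<open>[-r, r]\<close> the weight is at least \<open>1/4\<close> as soon as \<open>R \<ge> 2r\<close>.\<close>
  define r where "r = \<bar>x\<bar> + 1"
  have r: "r > 0" "x \<in> {-r..r}" by (auto simp: r_def)
  have "integral {-r..r} (\<lambda>x. (norm (w T x))\<^sup>2) \<le> 0"
  proof (rule tendsto_lowerbound)
    show "((\<lambda>R. 4 * (8 / R\<^sup>2 * M * T)) \<longlongrightarrow> 0) at_top"
    proof -
      have "((\<lambda>R. 4 * (8 * (inverse R)\<^sup>2 * M * T)) \<longlongrightarrow> 4 * (8 * 0\<^sup>2 * M * T)) at_top"
        by (intro tendsto_intros tendsto_inverse_0_at_top filterlim_ident)
      then show ?thesis by (simp add: field_simps)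
    qed
    have "integral {-r..r} (\<lambda>x. (norm (w T x))\<^sup>2) \<le> 4 * (8 / R\<^sup>2 * M * T)" if R: "R \<ge> 2 * r" for R
    proof -
      have R0: "R > 0" using R r by linarith
      have "integral {-r..r} (\<lambda>x. (norm (w T x))\<^sup>2)
          \<le> integral {-r..r} (\<lambda>x. 4 * ((1 - x\<^sup>2 / R\<^sup>2)\<^sup>2 * (norm (w T x))\<^sup>2))"
      proof (rule integral_le)
        fix x assume "x \<in> {-r..r}"
        then have "(2 * x)\<^sup>2 \<le> R\<^sup>2" using R r by (intro power2_le_iff_abs_le[THEN iffD2]) auto
        moreover have "2 * x\<^sup>2 \<le> (2 * x)\<^sup>2" by (simp add: power_mult_distrib)
        ultimately have "2 * x\<^sup>2 \<le> R\<^sup>2" by linarith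
        then have "1 / 2 \<le> 1 - x\<^sup>2 / R\<^sup>2" using R0 by (simp add: field_simps)
        from power_mono[OF this, of 2] have "1 \<le> 4 * (1 - x\<^sup>2 / R\<^sup>2)\<^sup>2"
          by (simp add: power_divide)
        from mult_right_mono[OF this, of "(norm (w T x))\<^sup>2"]
        show "(norm (w T x))\<^sup>2 \<le> 4 * ((1 - x\<^sup>2 / R\<^sup>2)\<^sup>2 * (norm (w T x))\<^sup>2)" by (simp add: mult.assoc)
      qed (use T R0 cont in \<open>auto intro!: integrable_continuous_real continuous_intros\<close>)
      also have "\<dots> = 4 * integral {-r..r} (\<lambda>x. (1 - x\<^sup>2 / R\<^sup>2)\<^sup>2 * (norm (w T x))\<^sup>2)" by simp
      also have "integral {-r..r} (\<lambda>x. (1 - x\<^sup>2 / R\<^sup>2)\<^sup>2 * (norm (w T x))\<^sup>2)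
        \<le> integral {-R..R} (\<lambda>x. (1 - x\<^sup>2 / R\<^sup>2)\<^sup>2 * (norm (w T x))\<^sup>2)"
        using T R0 R r cont by (intro integral_subset_le integrable_continuous_real) 
          (auto intro!: continuous_intros)
      also have "\<dots> \<le> 8 / R\<^sup>2 * M * T" by (rule main[OF R0])
      finally show ?thesis by simp
    qed
    then show "\<forall>\<^sub>F R in at_top. integral {-r..r} (\<lambda>x. (norm (w T x))\<^sup>2) \<le> 4 * (8 / R\<^sup>2 * M * T)"
      by (auto intro: eventually_at_top_linorderI)
  qed simp
  moreover have cs: "continuous_on {-r..r} (\<lambda>x. (norm (w T x))\<^sup>2)"
    using T cont by (auto intro!: continuous_intros)
  moreover have "0 \<le> integral {-r..r} (\<lambda>x. (norm (w T x))\<^sup>2)"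
    by (intro integral_nonneg integrable_continuous_real cs) auto
  ultimately have "integral {-r..r} (\<lambda>x. (norm (w T x))\<^sup>2) = 0" by simp
  then have "(norm (w T x))\<^sup>2 = 0"
    using integral_eq_0_iff[OF cs] r by auto
  then show ?thesis by (simp add: w_def)
qed

section \<open>The Mehler kernel\<close>

text \<open>The coefficients \<open>A\<close> and \<open>B\<close> of the quadratic form in the exponent of the kernel.\<close>

definition osc_coth :: "real \<Rightarrow> real \<Rightarrow> real" where
  "osc_coth a t = a * cosh (2 * a * t) / sinh (2 * a * t)"

definition osc_csch :: "real \<Rightarrow> real \<Rightarrow> real" where
  "osc_csch a t = a / sinh (2 * a * t)"

text \<open>The total mass \<open>\<integral> K(x, s, t) ds\<close> for \<open>t > 0\<close>; see lemma \<open>integral_K\<close>.\<close>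

definition osc_mass :: "real \<Rightarrow> real \<Rightarrow> real \<Rightarrow> real" where
  "osc_mass a t x = exp (- (a * tanh (2 * a * t) * x\<^sup>2 / 2)) / sqrt (cosh (2 * a * t))"

context
  fixes a t :: real
  assumes a: "a > 0" and t: "t > 0"
begin

lemma sinh_pos: "sinh (2 * a * t) > 0"
  using a t by simp

lemma osc_csch_pos: "osc_csch a t > 0"
  using a sinh_pos by (simp add: osc_csch_def)

lemma K_eq:
  "K a x s t = sqrt (osc_csch a t / (2 * pi))
     * exp (osc_csch a t * x * s - osc_coth a t / 2 * (x\<^sup>2 + s\<^sup>2))"
proof -
  define E where "E = exp (a * t)"
  define F where "F = exp (- a * t)"
  define S where "S = sinh (2 * a * t)"
  have EF: "E * F = 1" by (simp add: E_def F_def exp_minus)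
  have E2: "exp (2 * a * t) = E\<^sup>2" and F2: "exp (- 2 * a * t) = F\<^sup>2"
    by (simp_all add: E_def F_def flip: exp_double)
  have S: "E\<^sup>2 - F\<^sup>2 = 2 * S"
    using E2 F2 by (simp add: S_def sinh_def)
  have C: "cosh (2 * a * t) = (E\<^sup>2 + F\<^sup>2) / 2"
    using E2 F2 by (simp add: cosh_def)
  have S0: "S > 0" unfolding S_def by (rule sinh_pos)
  have "(2 * S) powr (- 1 / 2) = 1 / sqrt (2 * S)"
    using S0 powr_minus_divide[of "2 * S" "1/2"] by (simp add: powr_half_sqrt)
  then have const: "sqrt (a / pi) * (2 * S) powr (- 1 / 2) = sqrt (osc_csch a t / (2 * pi))"
    using a S0 by (simp add: osc_csch_def S_def real_sqrt_divide real_sqrt_mult)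
  have sq: "(E * x - F * s)\<^sup>2 = E\<^sup>2 * x\<^sup>2 - 2 * (x * s) + F\<^sup>2 * s\<^sup>2"
    using EF by algebra
  have "- (a * (E * x - F * s)\<^sup>2) / (2 * S) + a / 2 * (x\<^sup>2 - s\<^sup>2)
      = (- (a * (E * x - F * s)\<^sup>2) + a * S * (x\<^sup>2 - s\<^sup>2)) / (2 * S)"
    using S0 by (simp add: field_simps)
  also have "- (a * (E * x - F * s)\<^sup>2) + a * S * (x\<^sup>2 - s\<^sup>2)
      = 2 * a * (x * s) - a * ((E\<^sup>2 + F\<^sup>2) / 2) * (x\<^sup>2 + s\<^sup>2)"
    unfolding sq using S by algebra
  also have "\<dots> / (2 * S) = osc_csch a t * x * s - osc_coth a t / 2 * (x\<^sup>2 + s\<^sup>2)"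
    unfolding osc_csch_def osc_coth_def C S_def[symmetric] using S0 by (simp add: field_simps)
  finally show ?thesis
    unfolding K_def E2 F2 S by (simp only: const E_def[symmetric] F_def[symmetric])
qed

lemma K_pos: "K a x s t > 0"
  unfolding K_eq using osc_csch_pos by simp

lemma K_commute: "K a x s t = K a s x t"
  by (simp add: K_eq algebra_simps)

lemma K_eq_normal_density:
  "K a x s t = osc_mass a t x
     * normal_density (x / cosh (2 * a * t)) (sqrt (tanh (2 * a * t) / a)) s"
proof -
  define S where "S = sinh (2 * a * t)"
  define C where "C = cosh (2 * a * t)"
  have S0: "S > 0" unfolding S_def by (rule sinh_pos)
  have C0: "C > 0" by (simp add: C_def)
  have CS: "C\<^sup>2 = S\<^sup>2 + 1" unfolding C_def S_def by (rule cosh_square_eq)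
  have tanh: "tanh (2 * a * t) = S / C" by (simp add: tanh_def S_def C_def)
  have sq: "(sqrt (S / C / a))\<^sup>2 = S / C / a" using S0 C0 a by simp
  have const: "1 / sqrt C * (1 / sqrt (2 * pi * (S / C / a))) = sqrt (a / S / (2 * pi))"
    using S0 C0 a by (simp add: real_sqrt_divide real_sqrt_mult field_simps)
  have "- (a * (S / C) * x\<^sup>2 / 2) + - (s - x / C)\<^sup>2 / (2 * (S / C / a))
      = a / (2 * S * C) * (2 * C * x * s - (S\<^sup>2 + 1) * x\<^sup>2 - C\<^sup>2 * s\<^sup>2)"
    using S0 C0 a by (simp add: field_simps power2_eq_square)
  also have "\<dots> = a / S * x * s - a * C / S / 2 * (x\<^sup>2 + s\<^sup>2)"
    unfolding CS[symmetric] using S0 C0 by (simp add: field_simps power2_eq_square)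
  finally have ex: "exp (- (a * (S / C) * x\<^sup>2 / 2)) * exp (- (s - x / C)\<^sup>2 / (2 * (S / C / a)))
     = exp (a / S * x * s - a * C / S / 2 * (x\<^sup>2 + s\<^sup>2))"
    by (simp flip: exp_add)
  have "osc_mass a t x * normal_density (x / C) (sqrt (S / C / a)) s
      = (1 / sqrt C * (1 / sqrt (2 * pi * (S / C / a)))) *
        (exp (- (a * (S / C) * x\<^sup>2 / 2)) * exp (- (s - x / C)\<^sup>2 / (2 * (S / C / a))))"
    unfolding normal_density_def osc_mass_def sq tanh C_def[symmetric] by simp
  also have "\<dots> = K a x s t"
    unfolding const ex K_eq osc_csch_def osc_coth_def S_def[symmetric] C_def[symmetric] ..
  finally show ?thesis unfolding tanh C_def by simp
qed

lemma osc_mass_bounds: "0 \<le> osc_mass a t x" "osc_mass a t x \<le> 1"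
proof -
  have "exp (- (a * tanh (2 * a * t) * x\<^sup>2 / 2)) \<le> 1"
    using a t by simp
  also have "1 \<le> sqrt (cosh (2 * a * t))" using cosh_real_ge_1 by simp
  finally show "osc_mass a t x \<le> 1"
    unfolding osc_mass_def by (intro divide_le_eq_1_pos[THEN iffD2]) auto
qed (simp add: osc_mass_def)

lemma osc_coth_minus_csch: "osc_coth a t - osc_csch a t = a * tanh (a * t)"
proof -
  define p where "p = sinh (a * t)"
  define q where "q = cosh (a * t)"
  have pq: "p > 0" "q > 0" using a t by (auto simp: p_def q_def)
  have "cosh (2 * (a * t)) = 2 * p\<^sup>2 + 1" "sinh (2 * (a * t)) = 2 * p * q"
    unfolding cosh_double cosh_square_eq sinh_double p_def q_def by simp_all
  then have "osc_coth a t - osc_csch a t = a * (2 * p\<^sup>2 + 1) / (2 * p * q) - a / (2 * p * q)"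
    unfolding osc_coth_def osc_csch_def by (simp add: mult.assoc)
  also have "\<dots> = a * (p / q)" using pq by (simp add: field_simps power2_eq_square)
  finally show ?thesis by (simp add: p_def q_def tanh_def)
qed

lemma DERIV_K_x:
  "((\<lambda>x. K a x s t) has_real_derivative (osc_csch a t * s - osc_coth a t * x) * K a x s t) (at x)"
  unfolding K_eq by (auto intro!: derivative_eq_intros simp: algebra_simps)

lemma DERIV_osc_csch:
  "(osc_csch a has_real_derivative - 2 * osc_coth a t * osc_csch a t) (at t)"
  unfolding osc_csch_def[abs_def] osc_coth_def using sinh_pos
  by (auto intro!: derivative_eq_intros simp: field_simps power2_eq_square)

lemma DERIV_osc_coth:
  "(osc_coth a has_real_derivative - 2 * (osc_csch a t)\<^sup>2) (at t)"
proof -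
  have "(osc_coth a has_real_derivative
      2 * a\<^sup>2 * ((sinh (2 * a * t))\<^sup>2 - (cosh (2 * a * t))\<^sup>2) / (sinh (2 * a * t))\<^sup>2) (at t)"
    unfolding osc_coth_def[abs_def] using sinh_pos
    by (auto intro!: derivative_eq_intros simp: field_simps power2_eq_square)
  then show ?thesis by (simp add: cosh_square_eq osc_csch_def power_divide)
qed

lemma osc_coth_sq: "(osc_coth a t)\<^sup>2 - (osc_csch a t)\<^sup>2 = a\<^sup>2"
proof -
  have "(osc_coth a t)\<^sup>2 - (osc_csch a t)\<^sup>2
      = a\<^sup>2 * ((cosh (2 * a * t))\<^sup>2 - 1) / (sinh (2 * a * t))\<^sup>2"
    by (simp add: osc_coth_def osc_csch_def power_divide power_mult_distrib right_diff_distrib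
        diff_divide_distrib)
  then show ?thesis using sinh_pos a t by (simp add: cosh_square_eq)
qed

end

lemma DERIV_K_t:
  assumes a: "a > 0" and t: "t > 0"
  shows "((\<lambda>t. K a x s t) has_real_derivative
    ((osc_csch a t)\<^sup>2 * (x\<^sup>2 + s\<^sup>2) - osc_coth a t - 2 * osc_coth a t * osc_csch a t * x * s) * K a x s t) (at t)"
proof (rule has_field_derivative_transform_within_open[where S = "{0<..}"])
  define q where "q = sqrt (osc_csch a t / (2 * pi))"
  have q: "q > 0" "q * q = osc_csch a t / (2 * pi)"
    using osc_csch_pos[OF a t] by (auto simp: q_def)
  have "osc_csch a t / (2 * pi) > 0" using osc_csch_pos[OF a t] by simp
  then have "((\<lambda>t. sqrt (osc_csch a t / (2 * pi))) has_real_derivative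
      inverse q / 2 * (- 2 * osc_coth a t * osc_csch a t / (2 * pi))) (at t)"
    unfolding q_def by (auto intro!: derivative_eq_intros DERIV_osc_csch[OF a t])
  moreover have "inverse q / 2 * (- 2 * osc_coth a t * osc_csch a t / (2 * pi)) = - osc_coth a t * q"
  proof -
    have "- 2 * osc_coth a t * osc_csch a t / (2 * pi) = - 2 * osc_coth a t * (q * q)"
      unfolding q by simp
    then show ?thesis using q(1) by simp
  qed
  ultimately have dq: "((\<lambda>t. sqrt (osc_csch a t / (2 * pi))) has_real_derivative - osc_coth a t * q) (at t)"
    by simp
  have dexp: "((\<lambda>t. exp (osc_csch a t * x * s - osc_coth a t / 2 * (x\<^sup>2 + s\<^sup>2))) has_real_derivative
      exp (osc_csch a t * x * s - osc_coth a t / 2 * (x\<^sup>2 + s\<^sup>2))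
        * ((osc_csch a t)\<^sup>2 * (x\<^sup>2 + s\<^sup>2) - 2 * osc_coth a t * osc_csch a t * x * s)) (at t)"
    by (auto intro!: derivative_eq_intros DERIV_osc_csch[OF a t] DERIV_osc_coth[OF a t])
  from DERIV_mult[OF dq dexp]
  show "((\<lambda>t. sqrt (osc_csch a t / (2 * pi))
       * exp (osc_csch a t * x * s - osc_coth a t / 2 * (x\<^sup>2 + s\<^sup>2))) has_real_derivative
    ((osc_csch a t)\<^sup>2 * (x\<^sup>2 + s\<^sup>2) - osc_coth a t - 2 * osc_coth a t * osc_csch a t * x * s) * K a x s t) (at t)"
    unfolding K_eq[OF a t] q_def[symmetric] by (simp add: algebra_simps)
qed (use a t in \<open>auto simp: K_eq\<close>)

lemma osc_csch_antimono:
  assumes "a > 0" "0 < t0" "t0 \<le> t"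
  shows "osc_csch a t \<le> osc_csch a t0"
  unfolding osc_csch_def using assms by (intro divide_left_mono) auto

lemma osc_coth_le:
  assumes "a > 0" "0 < t"
  shows "osc_coth a t \<le> a + osc_csch a t"
  using osc_coth_minus_csch[OF assms] tanh_real_lt_1[of "a * t"] assms
  by (smt (verit) mult_less_cancel_left1)

lemma K_le_gaussian:
  assumes a: "a > 0" and t0: "0 < t0" "t0 \<le> t"
  shows "K a x s t \<le> sqrt (osc_csch a t0 / (2 * pi)) * exp (- (a * tanh (a * t0) / 2 * (x\<^sup>2 + s\<^sup>2)))"
proof -
  have t: "t > 0" using t0 by linarith
  have "osc_csch a t * x * s \<le> osc_csch a t * ((x\<^sup>2 + s\<^sup>2) / 2)"
    unfolding mult.assoc using osc_csch_pos[OF a t] zero_le_power2[of "x - s"]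
    by (intro mult_left_mono) (auto simp: power2_eq_square algebra_simps)
  then have "osc_csch a t * x * s - osc_coth a t / 2 * (x\<^sup>2 + s\<^sup>2)
      \<le> - ((osc_coth a t - osc_csch a t) / 2 * (x\<^sup>2 + s\<^sup>2))"
    by (simp add: field_simps)
  also have "\<dots> \<le> - (a * tanh (a * t0) / 2 * (x\<^sup>2 + s\<^sup>2))"
    unfolding osc_coth_minus_csch[OF a t] using a t0
    by (intro le_imp_neg_le mult_right_mono divide_right_mono mult_left_mono) auto
  finally show ?thesis
    unfolding K_eq[OF a t] using osc_csch_antimono[OF a t0] osc_csch_pos[OF a t]
    by (intro mult_mono) (auto intro: divide_right_mono)
qed

section \<open>Parameter integrals\<close>

lemma tendsto_integral_dominated:
  fixes F :: "'p::first_countable_topology \<Rightarrow> 'a \<Rightarrow> 'b::{banach, second_countable_topology}"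
  assumes [measurable]: "f \<in> borel_measurable M"
    and meas: "\<forall>\<^sub>F p in at p0 within S. F p \<in> borel_measurable M"
    and lim: "\<And>s. ((\<lambda>p. F p s) \<longlongrightarrow> f s) (at p0 within S)"
    and bound: "\<forall>\<^sub>F p in at p0 within S. \<forall>s. norm (F p s) \<le> g s"
    and g: "integrable M g"
  shows "((\<lambda>p. integral\<^sup>L M (F p)) \<longlongrightarrow> integral\<^sup>L M f) (at p0 within S)"
  unfolding tendsto_at_iff_sequentially o_def
proof (intro allI impI)
  fix X assume "\<forall>i. X i \<in> S - {p0}" and "X \<longlonglongrightarrow> p0"
  then have X: "filterlim X (at p0 within S) sequentially"
    by (auto simp: filterlim_at)
  have "\<forall>\<^sub>F i in sequentially. F (X i) \<in> borel_measurable M \<and> (\<forall>s. norm (F (X i) s) \<le> g s)"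
    using filterlim_iff[THEN iffD1, OF X] eventually_conj[OF meas bound] by blast
  then obtain N where N: "\<And>i. i \<ge> N \<Longrightarrow> F (X i) \<in> borel_measurable M"
    "\<And>i s. i \<ge> N \<Longrightarrow> norm (F (X i) s) \<le> g s"
    by (auto simp: eventually_sequentially)
  show "(\<lambda>i. integral\<^sup>L M (F (X i))) \<longlonglongrightarrow> integral\<^sup>L M f"
  proof (rule LIMSEQ_offset[where k = N], rule integral_dominated_convergence[where w = g])
    show "AE s in M. (\<lambda>i. F (X (i + N)) s) \<longlonglongrightarrow> f s"
      by (intro AE_I2 LIMSEQ_ignore_initial_segment filterlim_compose[OF lim X])
  qed (use N g in auto)
qed

text \<open>The bound is placed on the real factor \<open>F'\<close> only, so that the mean value
  inequality is applied to real functions and \<open>y\<close> enters merely as a weight.\<close>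

lemma has_vector_derivative_integral_dominated:
  fixes F F' :: "real \<Rightarrow> real \<Rightarrow> real" and y :: "real \<Rightarrow> 'b::{banach, second_countable_topology}"
  assumes \<delta>: "\<delta> > 0"
    and int: "\<And>r. \<bar>r - r0\<bar> < \<delta> \<Longrightarrow> integrable M (\<lambda>s. F r s *\<^sub>R y s)"
    and int': "integrable M (\<lambda>s. F' r0 s *\<^sub>R y s)"
    and deriv: "\<And>r s. \<bar>r - r0\<bar> < \<delta> \<Longrightarrow> ((\<lambda>r. F r s) has_real_derivative F' r s) (at r)"
    and bound: "\<And>r s. \<bar>r - r0\<bar> < \<delta> \<Longrightarrow> \<bar>F' r s\<bar> \<le> G s"
    and G: "integrable M (\<lambda>s. G s * norm (y s))"
  shows "((\<lambda>r. \<integral>s. F r s *\<^sub>R y s \<partial>M) has_vector_derivative (\<integral>s. F' r0 s *\<^sub>R y s \<partial>M)) (at r0)"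
proof -
  define Q where "Q r s = (1 / norm (r - r0)) *\<^sub>R
    (F r s *\<^sub>R y s - (F r0 s *\<^sub>R y s + (r - r0) *\<^sub>R (F' r0 s *\<^sub>R y s)))" for r s
  have Q_eq: "Q r s = ((1 / norm (r - r0)) *\<^sub>R (F r s - (F r0 s + (r - r0) * F' r0 s))) *\<^sub>R y s" for r s
    unfolding Q_def
    by (simp only: scaleR_scaleR[symmetric] scaleR_diff_left scaleR_add_left real_scaleR_def)
  have near: "\<forall>\<^sub>F r in at r0. \<bar>r - r0\<bar> < \<delta>"
    using \<delta> by (auto simp: eventually_at dist_real_def)
  have intQ: "integrable M (Q r)" if "\<bar>r - r0\<bar> < \<delta>" for r
    unfolding Q_def using int[OF that] int[of r0] int' \<delta>
    by (intro integrable_scaleR_right Bochner_Integration.integrable_diff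
        Bochner_Integration.integrable_add) auto
  have "((\<lambda>r. integral\<^sup>L M (Q r)) \<longlongrightarrow> integral\<^sup>L M (\<lambda>s. 0)) (at r0)"
  proof (rule tendsto_integral_dominated)
    show "integrable M (\<lambda>s. 2 * (G s * norm (y s)))" using G by simp
    show "\<forall>\<^sub>F r in at r0. Q r \<in> borel_measurable M"
      using near by eventually_elim (rule borel_measurable_integrable[OF intQ])
    fix s
    have "((\<lambda>r. ((1 / norm (r - r0)) *\<^sub>R (F r s - (F r0 s + (r - r0) * F' r0 s))) *\<^sub>R y s) \<longlongrightarrow> 0 *\<^sub>R y s) (at r0)"
      using deriv[of r0 s] \<delta>
      by (intro tendsto_scaleR tendsto_const)
        (auto simp: has_field_derivative_def has_derivative_at2 mult.commute)
    then show "((\<lambda>r. Q r s) \<longlongrightarrow> 0) (at r0)"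
      unfolding Q_eq[symmetric] by simp
  next
    show "\<forall>\<^sub>F r in at r0. \<forall>s. norm (Q r s) \<le> 2 * (G s * norm (y s))"
      using near
    proof eventually_elim
      case (elim r)
      show ?case
      proof (cases "r = r0")
        case True
        have "0 \<le> G s" for s using bound[of r0 s] \<delta> by auto
        then show ?thesis by (simp add: True Q_def)
      next
        case False
        show ?thesis
        proof
          fix s
          have "norm (F r s - F r0 s) \<le> G s * norm (r - r0)"
          proof (rule field_differentiable_bound[where S = "{r. \<bar>r - r0\<bar> < \<delta>}" and f' = "\<lambda>r. F' r s"])
            have "{r. \<bar>r - r0\<bar> < \<delta>} = ball r0 \<delta>" by (auto simp: dist_real_def)
            then show "convex {r. \<bar>r - r0\<bar> < \<delta>}" by simp
          qed (use elim \<delta> bound in \<open>auto intro!: DERIV_subset[OF deriv]\<close>)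
          then have "norm (F r s - F r0 s - (r - r0) * F' r0 s) \<le> 2 * G s * \<bar>r - r0\<bar>"
            using mult_right_mono[OF bound[of r0 s], of "\<bar>r - r0\<bar>"] \<delta>
              abs_triangle_ineq4[of "F r s - F r0 s" "(r - r0) * F' r0 s"]
            by (simp add: abs_mult mult.commute[of "\<bar>r - r0\<bar>"])
          then have "norm (F r s - F r0 s - (r - r0) * F' r0 s) / \<bar>r - r0\<bar> \<le> 2 * G s"
            using False by (simp add: divide_le_eq)
          then have "norm (F r s - F r0 s - (r - r0) * F' r0 s) / \<bar>r - r0\<bar> * norm (y s) \<le> 2 * G s * norm (y s)"
            by (rule mult_right_mono) simp
          moreover have "Q r s = ((F r s - F r0 s - (r - r0) * F' r0 s) / \<bar>r - r0\<bar>) *\<^sub>R y s"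
            by (simp add: Q_eq diff_diff_eq)
          ultimately show "norm (Q r s) \<le> 2 * (G s * norm (y s))"
            by (simp add: mult.assoc)
        qed
      qed
    qed
  qed simp
  then have lim: "((\<lambda>r. integral\<^sup>L M (Q r)) \<longlongrightarrow> 0) (at r0)" by simp
  show ?thesis
    unfolding has_vector_derivative_def has_derivative_at2
  proof
    show "((\<lambda>r. (1 / norm (r - r0)) *\<^sub>R ((\<integral>s. F r s *\<^sub>R y s \<partial>M) -
       ((\<integral>s. F r0 s *\<^sub>R y s \<partial>M) + (r - r0) *\<^sub>R (\<integral>s. F' r0 s *\<^sub>R y s \<partial>M)))) \<longlongrightarrow> 0) (at r0)"
    proof (rule Lim_transform_eventually[OF lim])
      show "\<forall>\<^sub>F r in at r0. integral\<^sup>L M (Q r) = (1 / norm (r - r0)) *\<^sub>R ((\<integral>s. F r s *\<^sub>R y s \<partial>M) -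
         ((\<integral>s. F r0 s *\<^sub>R y s \<partial>M) + (r - r0) *\<^sub>R (\<integral>s. F' r0 s *\<^sub>R y s \<partial>M)))"
        using near
      proof eventually_elim
        case (elim r)
        show ?case unfolding Q_def
          using int[OF elim] int[of r0] int' \<delta> 
          by (simp del: scaleR_scaleR)
      qed
    qed
  qed (rule bounded_linear_scaleR_left)
qed

lemma integrable_gaussian:
  assumes "c > 0"
  shows "integrable lebesgue (\<lambda>s::real. exp (- (c * s\<^sup>2)))"
proof -
  have "integrable lborel (\<lambda>s. sqrt (2 * pi * (sqrt (1 / (2 * c)))\<^sup>2) * normal_density 0 (sqrt (1 / (2 * c))) s)"
    by (intro integrable_mult_right integrable_normal_density) (use assms in auto)
  also have "(\<lambda>s. sqrt (2 * pi * (sqrt (1 / (2 * c)))\<^sup>2) * normal_density 0 (sqrt (1 / (2 * c))) s)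
     = (\<lambda>s. exp (- (c * s\<^sup>2)))"
    using assms by (auto simp: normal_density_def fun_eq_iff)
  finally show ?thesis by (subst integrable_completion) auto
qed

text \<open>From \<open>1 + |s| \<le> exp |s|\<close> and \<open>n |s| \<le> n\<^sup>2 / 2c + c s\<^sup>2 / 2\<close>.\<close>

lemma poly_gaussian_le:
  fixes s c :: real
  assumes "c > 0"
  shows "(1 + \<bar>s\<bar>) ^ n * exp (- (c * s\<^sup>2)) \<le> exp ((real n)\<^sup>2 / (2 * c)) * exp (- (c / 2 * s\<^sup>2))"
proof -
  have "(1 + \<bar>s\<bar>) ^ n \<le> exp \<bar>s\<bar> ^ n" by (intro power_mono) auto
  also have "\<dots> = exp (real n * \<bar>s\<bar>)" by (simp add: exp_of_nat_mult)
  finally have "(1 + \<bar>s\<bar>) ^ n * exp (- (c * s\<^sup>2)) \<le> exp (real n * \<bar>s\<bar>) * exp (- (c * s\<^sup>2))"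
    by (rule mult_right_mono) simp
  also have "\<dots> = exp (real n * \<bar>s\<bar> - c * s\<^sup>2)"
    unfolding mult_exp_exp by simp
  also have "\<dots> \<le> exp ((real n)\<^sup>2 / (2 * c) - c / 2 * s\<^sup>2)"
    unfolding exp_le_cancel_iff
  proof -
    have "0 \<le> (real n - c * \<bar>s\<bar>)\<^sup>2" by simp
    also have "\<dots> = (real n)\<^sup>2 - 2 * c * (real n * \<bar>s\<bar>) + c * c * s\<^sup>2"
      by (simp add: power2_diff power_mult_distrib power2_eq_square[of c])
    finally have "2 * c * (real n * \<bar>s\<bar> - c * s\<^sup>2) \<le> (real n)\<^sup>2 - c * c * s\<^sup>2"
      by (simp add: right_diff_distrib)
    then have "real n * \<bar>s\<bar> - c * s\<^sup>2 \<le> ((real n)\<^sup>2 - c * c * s\<^sup>2) / (2 * c)"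
      using assms by (simp add: pos_le_divide_eq mult.commute)
    also have "\<dots> = (real n)\<^sup>2 / (2 * c) - c / 2 * s\<^sup>2"
      using assms by (simp add: diff_divide_distrib)
    finally show "real n * \<bar>s\<bar> - c * s\<^sup>2 \<le> (real n)\<^sup>2 / (2 * c) - c / 2 * s\<^sup>2" .
  qed
  also have "\<dots> = exp ((real n)\<^sup>2 / (2 * c)) * exp (- (c / 2 * s\<^sup>2))"
    unfolding mult_exp_exp by simp
  finally show ?thesis .
qed

lemma integrable_poly_gaussian_mult:
  assumes c: "c > 0" and y: "square_integrable y"
  shows "integrable lebesgue (\<lambda>s. (1 + \<bar>s\<bar>) ^ n * exp (- (c * s\<^sup>2)) * norm (y s))"
proof -
  have [measurable]: "y \<in> borel_measurable lebesgue" using y by (simp add: square_integrable_def)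
  have [measurable]: "(\<lambda>x. x) \<in> borel_measurable lebesgue" by (simp add: measurable_completion)
  have pq: "p * q \<le> p\<^sup>2 + q\<^sup>2" if "p \<ge> 0" "q \<ge> 0" for p q :: real
    using sum_squares_bound[of p q] mult_nonneg_nonneg[OF that] by simp
  define D where "D = exp ((real n)\<^sup>2 / (2 * c))"
  show ?thesis
  proof (rule Bochner_Integration.integrable_bound)
    show "integrable lebesgue (\<lambda>s. D\<^sup>2 * exp (- (c * s\<^sup>2)) + (norm (y s))\<^sup>2)"
      using y integrable_gaussian[OF c] by (auto simp: square_integrable_def)
    show "AE s in lebesgue. norm ((1 + \<bar>s\<bar>) ^ n * exp (- (c * s\<^sup>2)) * norm (y s))
        \<le> norm (D\<^sup>2 * exp (- (c * s\<^sup>2)) + (norm (y s))\<^sup>2)"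
    proof (rule AE_I2)
      fix s
      have "(1 + \<bar>s\<bar>) ^ n * exp (- (c * s\<^sup>2)) * norm (y s) \<le> D * exp (- (c / 2 * s\<^sup>2)) * norm (y s)"
        using poly_gaussian_le[OF c] unfolding D_def by (intro mult_right_mono) auto
      also have "\<dots> \<le> (D * exp (- (c / 2 * s\<^sup>2)))\<^sup>2 + (norm (y s))\<^sup>2"
        by (rule pq) (auto simp: D_def)
      also have "\<dots> = D\<^sup>2 * exp (- (c * s\<^sup>2)) + (norm (y s))\<^sup>2"
        by (simp add: power_mult_distrib exp_double[symmetric])
      finally show "norm ((1 + \<bar>s\<bar>) ^ n * exp (- (c * s\<^sup>2)) * norm (y s))
        \<le> norm (D\<^sup>2 * exp (- (c * s\<^sup>2)) + (norm (y s))\<^sup>2)" by simp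
    qed
  qed measurable
qed

section \<open>Moments of the kernel\<close>

text \<open>The integral \<open>\<integral> s\<^sup>k K(x, s, t) y(s) ds\<close>; for \<open>k = 0\<close> and \<open>t > 0\<close> it is the solution
  with initial datum \<open>y\<close>.\<close>

definition moment :: "real \<Rightarrow> (real \<Rightarrow> complex) \<Rightarrow> nat \<Rightarrow> real \<Rightarrow> real \<Rightarrow> complex" where
  "moment a y k t x = (\<integral>s. (s ^ k * K a x s t) *\<^sub>R y s \<partial>lebesgue)"

lemma borel_measurable_lebesgue_ident [measurable]: "(\<lambda>x::real. x) \<in> borel_measurable lebesgue"
  by (simp add: measurable_completion)

lemma measurable_K [measurable]: "(\<lambda>s. K a x s t) \<in> borel_measurable lebesgue"
  unfolding K_def by measurable

lemma continuous_on_osc: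
  assumes "a > 0"
  shows "continuous_on {0<..} (osc_coth a)" "continuous_on {0<..} (osc_csch a)"
  using DERIV_osc_coth[OF assms] DERIV_osc_csch[OF assms]
  by (auto intro!: continuous_at_imp_continuous_on DERIV_isCont)

lemma continuous_on_K:
  assumes "a > 0"
  shows "continuous_on ({0<..} \<times> UNIV) (\<lambda>(t, x). K a x s t)"
proof -
  have *: "continuous_on ({0<..} \<times> UNIV) (\<lambda>p :: real \<times> real. osc_coth a (fst p))"
    "continuous_on ({0<..} \<times> UNIV) (\<lambda>p :: real \<times> real. osc_csch a (fst p))"
    by (auto intro!: continuous_on_compose2[OF continuous_on_osc(1)[OF assms]]
        continuous_on_compose2[OF continuous_on_osc(2)[OF assms]] continuous_intros)
  have "continuous_on ({0<..} \<times> UNIV) (\<lambda>p. sqrt (osc_csch a (fst p) / (2 * pi))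
     * exp (osc_csch a (fst p) * snd p * s - osc_coth a (fst p) / 2 * ((snd p)\<^sup>2 + s\<^sup>2)))"
    by (intro continuous_intros *) auto
  then show ?thesis
    by (rule continuous_on_eq) (use assms in \<open>auto simp: K_eq\<close>)
qed

lemma K_bound:
  assumes a: "a > 0" and t0: "t0 > 0"
  obtains C c where "C > 0" "c > 0"
    "\<And>t x s. t0 \<le> t \<Longrightarrow> K a x s t \<le> C * exp (- (c * x\<^sup>2)) * exp (- (c * s\<^sup>2))"
proof
  show "sqrt (osc_csch a t0 / (2 * pi)) > 0" using osc_csch_pos[OF assms] by simp
  show "a * tanh (a * t0) / 2 > 0" using a t0 by simp
  show "K a x s t \<le> sqrt (osc_csch a t0 / (2 * pi)) * exp (- (a * tanh (a * t0) / 2 * x\<^sup>2))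
      * exp (- (a * tanh (a * t0) / 2 * s\<^sup>2))" if "t0 \<le> t" for t x s
    using K_le_gaussian[OF assms that, of x s]
    unfolding mult.assoc mult_exp_exp by (simp add: algebra_simps)
qed

lemma moment_kernel_bound:
  assumes a: "a > 0" and t0: "t0 > 0"
  obtains C c where "C > 0" "c > 0"
    "\<And>k t x s. t0 \<le> t \<Longrightarrow> \<bar>s ^ k * K a x s t\<bar> \<le> C * ((1 + \<bar>s\<bar>) ^ k * exp (- (c * s\<^sup>2)))"
proof -
  obtain C c where C: "C > 0" "c > 0"
    "\<And>t x s. t0 \<le> t \<Longrightarrow> K a x s t \<le> C * exp (- (c * x\<^sup>2)) * exp (- (c * s\<^sup>2))"
    using K_bound[OF a t0] by metis
  show ?thesis
  proof (rule that[OF C(1,2)])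
    fix k t x s assume t: "t0 \<le> t"
    have "\<bar>s ^ k * K a x s t\<bar> = \<bar>s\<bar> ^ k * K a x s t"
      using K_pos[OF a, of t] t t0 by (simp add: abs_mult power_abs less_imp_le)
    also have "\<dots> \<le> (1 + \<bar>s\<bar>) ^ k * (C * 1 * exp (- (c * s\<^sup>2)))"
    proof (intro mult_mono power_mono)
      have "C * exp (- (c * x\<^sup>2)) * exp (- (c * s\<^sup>2)) \<le> C * 1 * exp (- (c * s\<^sup>2))"
        using C by (intro mult_right_mono mult_left_mono) auto
      then show "K a x s t \<le> C * 1 * exp (- (c * s\<^sup>2))" using C(3)[OF t, of x s] by linarith
    qed (use K_pos[OF a, of t] t t0 in \<open>auto simp: less_imp_le\<close>)
    finally show "\<bar>s ^ k * K a x s t\<bar> \<le> C * ((1 + \<bar>s\<bar>) ^ k * exp (- (c * s\<^sup>2)))"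
      by (simp add: mult_ac)
  qed
qed

context
  fixes a :: real and y :: "real \<Rightarrow> complex"
  assumes a: "a > 0" and y: "square_integrable y"
begin

lemmas measurable_y [measurable] = square_integrable_measurable[OF y]

lemma integrable_moment:
  assumes t: "t > 0"
  shows "integrable lebesgue (\<lambda>s. (s ^ k * K a x s t) *\<^sub>R y s)"
proof -
  obtain C c where C: "C > 0" "c > 0"
    "\<And>k \<tau> x s. t \<le> \<tau> \<Longrightarrow> \<bar>s ^ k * K a x s \<tau>\<bar> \<le> C * ((1 + \<bar>s\<bar>) ^ k * exp (- (c * s\<^sup>2)))"
    using moment_kernel_bound[OF a t] by metis
  show ?thesis
  proof (rule Bochner_Integration.integrable_bound)
    show "integrable lebesgue (\<lambda>s. C * ((1 + \<bar>s\<bar>) ^ k * exp (- (c * s\<^sup>2)) * norm (y s)))"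
      by (intro integrable_mult_right integrable_poly_gaussian_mult y C)
    show "AE s in lebesgue. norm ((s ^ k * K a x s t) *\<^sub>R y s)
        \<le> norm (C * ((1 + \<bar>s\<bar>) ^ k * exp (- (c * s\<^sup>2)) * norm (y s)))"
    proof (rule AE_I2)
      fix s
      have "norm ((s ^ k * K a x s t) *\<^sub>R y s) \<le> C * ((1 + \<bar>s\<bar>) ^ k * exp (- (c * s\<^sup>2))) * norm (y s)"
        unfolding norm_scaleR using C(3)[OF order_refl] by (rule mult_right_mono) simp
      then show "norm ((s ^ k * K a x s t) *\<^sub>R y s)
        \<le> norm (C * ((1 + \<bar>s\<bar>) ^ k * exp (- (c * s\<^sup>2)) * norm (y s)))"
        using C(1) by (simp add: mult.assoc)
    qed
  qed measurable
qed

lemma continuous_on_moment: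
  "continuous_on ({0<..} \<times> UNIV) (\<lambda>(t, x). moment a y k t x)"
  unfolding continuous_on_def
proof
  fix p :: "real \<times> real" assume p: "p \<in> {0<..} \<times> UNIV"
  define t0 where "t0 = fst p / 2"
  have t0: "t0 > 0" "t0 < fst p" using p by (auto simp: t0_def)
  obtain C c where C: "C > 0" "c > 0"
    "\<And>k \<tau> x s. t0 \<le> \<tau> \<Longrightarrow> \<bar>s ^ k * K a x s \<tau>\<bar> \<le> C * ((1 + \<bar>s\<bar>) ^ k * exp (- (c * s\<^sup>2)))"
    using moment_kernel_bound[OF a t0(1)] by metis
  have "((\<lambda>q. \<integral>s. (s ^ k * K a (snd q) s (fst q)) *\<^sub>R y s \<partial>lebesgue)
    \<longlongrightarrow> (\<integral>s. (s ^ k * K a (snd p) s (fst p)) *\<^sub>R y s \<partial>lebesgue)) (at p within {0<..} \<times> UNIV)"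
  proof (rule tendsto_integral_dominated)
    show "integrable lebesgue (\<lambda>s. C * ((1 + \<bar>s\<bar>) ^ k * exp (- (c * s\<^sup>2)) * norm (y s)))"
      by (intro integrable_mult_right integrable_poly_gaussian_mult y C)
    have "\<forall>\<^sub>F q in at p within {0<..} \<times> UNIV. t0 < fst q"
      using t0 by (intro order_tendstoD(1)[where y = "fst p"] tendsto_fst tendsto_ident_at)
    then show "\<forall>\<^sub>F q in at p within {0<..} \<times> UNIV. \<forall>s. norm ((s ^ k * K a (snd q) s (fst q)) *\<^sub>R y s)
        \<le> C * ((1 + \<bar>s\<bar>) ^ k * exp (- (c * s\<^sup>2)) * norm (y s))"
    proof eventually_elim
      case (elim q)
      show ?case
      proof
        fix s
        have "norm ((s ^ k * K a (snd q) s (fst q)) *\<^sub>R y s) \<le> C * ((1 + \<bar>s\<bar>) ^ k * exp (- (c * s\<^sup>2))) * norm (y s)"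
          unfolding norm_scaleR using C(3)[OF less_imp_le[OF elim]] by (rule mult_right_mono) simp
        then show "norm ((s ^ k * K a (snd q) s (fst q)) *\<^sub>R y s)
          \<le> C * ((1 + \<bar>s\<bar>) ^ k * exp (- (c * s\<^sup>2)) * norm (y s))"
          by (simp add: mult.assoc)
      qed
    qed
    fix s
    have "((\<lambda>q. K a (snd q) s (fst q)) \<longlongrightarrow> K a (snd p) s (fst p)) (at p within {0<..} \<times> UNIV)"
      using continuous_on_K[OF a, of s] p unfolding continuous_on_def split_beta by blast
    then show "((\<lambda>q. (s ^ k * K a (snd q) s (fst q)) *\<^sub>R y s) \<longlongrightarrow>
        (s ^ k * K a (snd p) s (fst p)) *\<^sub>R y s) (at p within {0<..} \<times> UNIV)"
      by (intro tendsto_intros)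
  qed measurable
  then show "((\<lambda>(t, x). moment a y k t x) \<longlongrightarrow> (case p of (t, x) \<Rightarrow> moment a y k t x)) (at p within {0<..} \<times> UNIV)"
    by (simp add: moment_def case_prod_unfold)
qed

lemma moment_deriv_x:
  assumes t: "t > 0"
  shows "(moment a y k t has_vector_derivative
    osc_csch a t *\<^sub>R moment a y (Suc k) t x - (osc_coth a t * x) *\<^sub>R moment a y k t x) (at x)"
proof -
  define A where "A = osc_coth a t"
  define B where "B = osc_csch a t"
  obtain C c where C: "C > 0" "c > 0"
    "\<And>k \<tau> x s. t \<le> \<tau> \<Longrightarrow> \<bar>s ^ k * K a x s \<tau>\<bar> \<le> C * ((1 + \<bar>s\<bar>) ^ k * exp (- (c * s\<^sup>2)))"
    using moment_kernel_bound[OF a t] by metis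
  define G where "G s = (\<bar>B\<bar> + \<bar>A\<bar> * (\<bar>x\<bar> + 1)) * C * ((1 + \<bar>s\<bar>) ^ Suc k * exp (- (c * s\<^sup>2)))" for s
  have split: "(s ^ k * ((B * s - A * x) * K a x s t)) *\<^sub>R y s
      = B *\<^sub>R ((s ^ Suc k * K a x s t) *\<^sub>R y s) - (A * x) *\<^sub>R ((s ^ k * K a x s t) *\<^sub>R y s)" for s
  proof -
    have "s ^ k * ((B * s - A * x) * K a x s t) = B * (s ^ Suc k * K a x s t) - (A * x) * (s ^ k * K a x s t)"
      by (simp add: algebra_simps)
    then show ?thesis by (simp add: scaleR_diff_left)
  qed
  have "((\<lambda>x. \<integral>s. (s ^ k * K a x s t) *\<^sub>R y s \<partial>lebesgue) has_vector_derivative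
      (\<integral>s. (s ^ k * ((B * s - A * x) * K a x s t)) *\<^sub>R y s \<partial>lebesgue)) (at x)"
  proof (rule has_vector_derivative_integral_dominated[where \<delta> = 1 and G = G])
    show "integrable lebesgue (\<lambda>s. (s ^ k * ((B * s - A * x) * K a x s t)) *\<^sub>R y s)"
      unfolding split by (intro Bochner_Integration.integrable_diff integrable_scaleR_right integrable_moment t)
    show "integrable lebesgue (\<lambda>s. G s * norm (y s))"
      unfolding G_def mult.assoc[of "(\<bar>B\<bar> + \<bar>A\<bar> * (\<bar>x\<bar> + 1)) * C"]
      by (intro integrable_mult_right integrable_poly_gaussian_mult y C)
    show "((\<lambda>x. s ^ k * K a x s t) has_real_derivative s ^ k * ((B * s - A * r) * K a r s t)) (at r)" for r s
      unfolding A_def B_def by (intro DERIV_cmult DERIV_K_x a t)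
    fix r s :: real assume r: "\<bar>r - x\<bar> < 1"
    have "\<bar>s ^ k * ((B * s - A * r) * K a r s t)\<bar> = \<bar>B * s - A * r\<bar> * \<bar>s ^ k * K a r s t\<bar>"
      by (simp add: abs_mult mult_ac)
    also have "\<dots> \<le> ((\<bar>B\<bar> + \<bar>A\<bar> * (\<bar>x\<bar> + 1)) * (1 + \<bar>s\<bar>)) * (C * ((1 + \<bar>s\<bar>) ^ k * exp (- (c * s\<^sup>2))))"
    proof (intro mult_mono C(3))
      have "\<bar>B * s - A * r\<bar> \<le> \<bar>B\<bar> * \<bar>s\<bar> + \<bar>A\<bar> * \<bar>r\<bar>"
        using abs_triangle_ineq4[of "B * s" "A * r"] by (simp add: abs_mult)
      also have "\<dots> \<le> \<bar>B\<bar> * (1 + \<bar>s\<bar>) + (\<bar>A\<bar> * (\<bar>x\<bar> + 1)) * (1 + \<bar>s\<bar>)"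
      proof (intro add_mono mult_left_mono)
        have "\<bar>A\<bar> * \<bar>r\<bar> \<le> \<bar>A\<bar> * (\<bar>x\<bar> + 1)" using r by (intro mult_left_mono) auto
        also have "\<dots> \<le> (\<bar>A\<bar> * (\<bar>x\<bar> + 1)) * (1 + \<bar>s\<bar>)" by (simp add: mult_left_mono distrib_left)
        finally show "\<bar>A\<bar> * \<bar>r\<bar> \<le> (\<bar>A\<bar> * (\<bar>x\<bar> + 1)) * (1 + \<bar>s\<bar>)" .
      qed auto
      finally show "\<bar>B * s - A * r\<bar> \<le> (\<bar>B\<bar> + \<bar>A\<bar> * (\<bar>x\<bar> + 1)) * (1 + \<bar>s\<bar>)"
        by (simp only: distrib_right)
    qed auto
    finally show "\<bar>s ^ k * ((B * s - A * r) * K a r s t)\<bar> \<le> G s"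
      by (simp only: G_def power_Suc mult_ac)
  qed (auto intro: integrable_moment t)
  moreover have "(\<integral>s. (s ^ k * ((B * s - A * x) * K a x s t)) *\<^sub>R y s \<partial>lebesgue)
      = B *\<^sub>R moment a y (Suc k) t x - (A * x) *\<^sub>R moment a y k t x"
    unfolding split moment_def
    by (subst Bochner_Integration.integral_diff)
      (auto intro!: integrable_scaleR_right integrable_moment t simp del: scaleR_scaleR power_Suc)
  ultimately show ?thesis by (simp add: moment_def[abs_def] A_def B_def)
qed

lemma moment_deriv_t:
  assumes t: "t > 0"
  shows "((\<lambda>t. moment a y 0 t x) has_vector_derivative
    (osc_csch a t)\<^sup>2 *\<^sub>R moment a y 2 t x - (2 * osc_coth a t * osc_csch a t * x) *\<^sub>R moment a y 1 t x
     + ((osc_csch a t)\<^sup>2 * x\<^sup>2 - osc_coth a t) *\<^sub>R moment a y 0 t x) (at t)"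
proof -
  define A where "A = osc_coth a"
  define B where "B = osc_csch a"
  define F' where "F' \<tau> s = ((B \<tau>)\<^sup>2 * (x\<^sup>2 + s\<^sup>2) - A \<tau> - 2 * A \<tau> * B \<tau> * x * s) * K a x s \<tau>" for \<tau> s
  define t0 where "t0 = t / 2"
  have t0: "t0 > 0" using t by (simp add: t0_def)
  obtain C c where C: "C > 0" "c > 0"
    "\<And>k \<tau> x s. t0 \<le> \<tau> \<Longrightarrow> \<bar>s ^ k * K a x s \<tau>\<bar> \<le> C * ((1 + \<bar>s\<bar>) ^ k * exp (- (c * s\<^sup>2)))"
    using moment_kernel_bound[OF a t0] by metis
  define b where "b = B t0"
  have b: "b > 0" unfolding b_def B_def by (rule osc_csch_pos[OF a t0])
  define E where "E = b\<^sup>2 * (x\<^sup>2 + 1) + (a + b) + 2 * (a + b) * b * \<bar>x\<bar>"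
  define G where "G s = E * C * ((1 + \<bar>s\<bar>) ^ 2 * exp (- (c * s\<^sup>2)))" for s
  have split: "F' t s *\<^sub>R y s
      = (B t)\<^sup>2 *\<^sub>R ((s ^ 2 * K a x s t) *\<^sub>R y s) - (2 * A t * B t * x) *\<^sub>R ((s ^ 1 * K a x s t) *\<^sub>R y s)
        + ((B t)\<^sup>2 * x\<^sup>2 - A t) *\<^sub>R ((s ^ 0 * K a x s t) *\<^sub>R y s)" for s
  proof -
    have "F' t s = (B t)\<^sup>2 * (s ^ 2 * K a x s t) - (2 * A t * B t * x) * (s ^ 1 * K a x s t)
        + ((B t)\<^sup>2 * x\<^sup>2 - A t) * (s ^ 0 * K a x s t)"
      unfolding F'_def by (simp add: algebra_simps)
    then show ?thesis by (simp only: scaleR_diff_left scaleR_add_left scaleR_scaleR)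
  qed
  have "((\<lambda>t. \<integral>s. (s ^ 0 * K a x s t) *\<^sub>R y s \<partial>lebesgue) has_vector_derivative
      (\<integral>s. F' t s *\<^sub>R y s \<partial>lebesgue)) (at t)"
  proof (rule has_vector_derivative_integral_dominated[where \<delta> = t0 and G = G])
    show "integrable lebesgue (\<lambda>s. F' t s *\<^sub>R y s)"
      unfolding split by (intro Bochner_Integration.integrable_diff Bochner_Integration.integrable_add
          integrable_scaleR_right integrable_moment t)
    show "integrable lebesgue (\<lambda>s. G s * norm (y s))"
      unfolding G_def mult.assoc[of "E * C"]
      by (intro integrable_mult_right integrable_poly_gaussian_mult y C)
    fix \<tau> :: real assume "\<bar>\<tau> - t\<bar> < t0"
    then have \<tau>: "\<tau> > t0" "\<tau> > 0" using t unfolding t0_def by linarith+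
    then show "integrable lebesgue (\<lambda>s. (s ^ 0 * K a x s \<tau>) *\<^sub>R y s)" by (intro integrable_moment)
    fix s :: real
    show "((\<lambda>\<tau>. s ^ 0 * K a x s \<tau>) has_real_derivative F' \<tau> s) (at \<tau>)"
      using DERIV_K_t[OF a \<tau>(2)] by (simp add: F'_def A_def B_def)
    have B: "0 < B \<tau>" "B \<tau> \<le> b"
      unfolding b_def B_def using osc_csch_pos[OF a \<tau>(2)] osc_csch_antimono[OF a t0] \<tau> by auto
    have A: "0 < A \<tau>" "A \<tau> \<le> a + b"
    proof -
      have "A \<tau> \<le> a + B \<tau>" unfolding A_def B_def by (rule osc_coth_le[OF a \<tau>(2)])
      then show "A \<tau> \<le> a + b" using B by simp
      have "A \<tau> - B \<tau> > 0" unfolding A_def B_def osc_coth_minus_csch[OF a \<tau>(2)] using a \<tau> by simp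
      then show "0 < A \<tau>" using B by simp
    qed
    have one: "1 \<le> (1 + \<bar>s\<bar>)\<^sup>2" by (rule one_le_power) simp
    have s1: "\<bar>s\<bar> \<le> (1 + \<bar>s\<bar>)\<^sup>2" by (simp add: power2_eq_square algebra_simps)
    have s2: "s\<^sup>2 \<le> (1 + \<bar>s\<bar>)\<^sup>2" by (simp add: power2_eq_square algebra_simps)
    have "\<bar>(B \<tau>)\<^sup>2 * (x\<^sup>2 + s\<^sup>2) - A \<tau> - 2 * A \<tau> * B \<tau> * x * s\<bar>
        \<le> (B \<tau>)\<^sup>2 * (x\<^sup>2 + s\<^sup>2) + A \<tau> + 2 * A \<tau> * B \<tau> * \<bar>x\<bar> * \<bar>s\<bar>"
    proof -
      have "\<bar>(B \<tau>)\<^sup>2 * (x\<^sup>2 + s\<^sup>2)\<bar> = (B \<tau>)\<^sup>2 * (x\<^sup>2 + s\<^sup>2)" by simp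
      moreover have "\<bar>2 * A \<tau> * B \<tau> * x * s\<bar> = 2 * A \<tau> * B \<tau> * \<bar>x\<bar> * \<bar>s\<bar>"
        using A B by (simp add: abs_mult)
      ultimately show ?thesis using A by linarith
    qed
    also have "\<dots> \<le> b\<^sup>2 * ((x\<^sup>2 + 1) * (1 + \<bar>s\<bar>)\<^sup>2) + (a + b) * (1 + \<bar>s\<bar>)\<^sup>2
        + 2 * (a + b) * b * \<bar>x\<bar> * (1 + \<bar>s\<bar>)\<^sup>2"
    proof (intro add_mono)
      have "x\<^sup>2 * 1 \<le> x\<^sup>2 * (1 + \<bar>s\<bar>)\<^sup>2" using one by (rule mult_left_mono) simp
      then have "x\<^sup>2 + s\<^sup>2 \<le> (x\<^sup>2 + 1) * (1 + \<bar>s\<bar>)\<^sup>2" using s2 by (simp only: distrib_right mult_1 mult_1_right)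
      then show "(B \<tau>)\<^sup>2 * (x\<^sup>2 + s\<^sup>2) \<le> b\<^sup>2 * ((x\<^sup>2 + 1) * (1 + \<bar>s\<bar>)\<^sup>2)"
        using B by (intro mult_mono power_mono) auto
      show "A \<tau> \<le> (a + b) * (1 + \<bar>s\<bar>)\<^sup>2"
        using mult_mono[OF A(2) one] A a b by simp
      show "2 * A \<tau> * B \<tau> * \<bar>x\<bar> * \<bar>s\<bar> \<le> 2 * (a + b) * b * \<bar>x\<bar> * (1 + \<bar>s\<bar>)\<^sup>2"
        using A B s1 a b by (intro mult_mono) auto
    qed
    also have "\<dots> = E * (1 + \<bar>s\<bar>)\<^sup>2" unfolding E_def by (simp only: distrib_right mult.assoc)
    finally have *: "\<bar>(B \<tau>)\<^sup>2 * (x\<^sup>2 + s\<^sup>2) - A \<tau> - 2 * A \<tau> * B \<tau> * x * s\<bar> \<le> E * (1 + \<bar>s\<bar>)\<^sup>2" .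
    have "\<bar>F' \<tau> s\<bar> = \<bar>(B \<tau>)\<^sup>2 * (x\<^sup>2 + s\<^sup>2) - A \<tau> - 2 * A \<tau> * B \<tau> * x * s\<bar> * \<bar>s ^ 0 * K a x s \<tau>\<bar>"
      unfolding F'_def by (simp add: abs_mult)
    also have "\<dots> \<le> (E * (1 + \<bar>s\<bar>)\<^sup>2) * (C * ((1 + \<bar>s\<bar>) ^ 0 * exp (- (c * s\<^sup>2))))"
    proof (intro mult_mono * C(3))
      have "0 \<le> E" unfolding E_def using a b by simp
      then show "0 \<le> E * (1 + \<bar>s\<bar>)\<^sup>2" by simp
    qed (use \<tau> in auto)
    finally show "\<bar>F' \<tau> s\<bar> \<le> G s" by (simp add: G_def mult_ac)
  qed (rule t0)
  moreover have "(\<integral>s. F' t s *\<^sub>R y s \<partial>lebesgue)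
      = (B t)\<^sup>2 *\<^sub>R moment a y 2 t x - (2 * A t * B t * x) *\<^sub>R moment a y 1 t x
        + ((B t)\<^sup>2 * x\<^sup>2 - A t) *\<^sub>R moment a y 0 t x"
    unfolding split moment_def
    using integrable_moment[OF t, of 0 x] integrable_moment[OF t, of 1 x] integrable_moment[OF t, of 2 x]
    by (simp del: scaleR_scaleR power_0 power_one_right One_nat_def)
  ultimately show ?thesis unfolding moment_def[symmetric] A_def B_def by simp
qed

end

section \<open>The kernel integral solves the equation\<close>

lemma C12_heat_moment:
  assumes a: "a > 0" and y: "square_integrable y"
    and u: "\<And>t x. t > 0 \<Longrightarrow> u t x = moment a y 0 t x"
  shows "C12 u" "\<And>t x. t > 0 \<Longrightarrow> harmonic_oscillator a (u t) x = dt u t x"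
proof -
  define A where "A = osc_coth a"
  define B where "B = osc_csch a"
  define M where "M = moment a y"
  define U1 where "U1 t x = B t *\<^sub>R M 1 t x - (A t * x) *\<^sub>R M 0 t x" for t x
  define U2 where "U2 t x = (B t)\<^sup>2 *\<^sub>R M 2 t x - (2 * A t * B t * x) *\<^sub>R M 1 t x
      + ((A t)\<^sup>2 * x\<^sup>2 - A t) *\<^sub>R M 0 t x" for t x
  define Ut where "Ut t x = (B t)\<^sup>2 *\<^sub>R M 2 t x - (2 * A t * B t * x) *\<^sub>R M 1 t x
      + ((B t)\<^sup>2 * x\<^sup>2 - A t) *\<^sub>R M 0 t x" for t x
  have u': "u t = M 0 t" if "t > 0" for t using u[OF that] by (auto simp: M_def)
  have dM: "(M k t has_vector_derivative B t *\<^sub>R M (Suc k) t x - (A t * x) *\<^sub>R M k t x) (at x)"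
    if "t > 0" for k t x
    unfolding M_def A_def B_def by (rule moment_deriv_x[OF a y that])
  have d1: "(u t has_vector_derivative U1 t x) (at x)" if "t > 0" for t x
    using dM[OF that, of 0 x] by (simp add: u'[OF that] U1_def)
  have dx1: "dx (u t) = U1 t" if "t > 0" for t
    using vector_derivative_at[OF d1[OF that]] by (auto simp: dx_def)
  have d2: "(U1 t has_vector_derivative U2 t x) (at x)" if "t > 0" for t x
  proof -
    have "((\<lambda>x. B t *\<^sub>R M 1 t x - (A t * x) *\<^sub>R M 0 t x) has_vector_derivative
        B t *\<^sub>R (B t *\<^sub>R M (Suc 1) t x - (A t * x) *\<^sub>R M 1 t x)
        - ((A t * x) *\<^sub>R (B t *\<^sub>R M (Suc 0) t x - (A t * x) *\<^sub>R M 0 t x) + A t *\<^sub>R M 0 t x)) (at x)"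
      by (intro has_vector_derivative_diff has_vector_derivative_scaleR dM that
          bounded_linear.has_vector_derivative[OF bounded_linear_scaleR_right])
        (auto intro!: derivative_eq_intros)
    moreover have "B t *\<^sub>R (B t *\<^sub>R M (Suc 1) t x - (A t * x) *\<^sub>R M 1 t x)
        - ((A t * x) *\<^sub>R (B t *\<^sub>R M (Suc 0) t x - (A t * x) *\<^sub>R M 0 t x) + A t *\<^sub>R M 0 t x) = U2 t x"
      unfolding U2_def
      by (simp add: scaleR_conv_of_real algebra_simps power2_eq_square numeral_2_eq_2)
    ultimately show ?thesis by (simp add: U1_def[abs_def])
  qed
  have dx2: "dx (dx (u t)) = U2 t" if "t > 0" for t
    unfolding dx1[OF that] using vector_derivative_at[OF d2[OF that]] by (auto simp: dx_def)
  have d3: "((\<lambda>\<tau>. u \<tau> x) has_vector_derivative Ut t x) (at t)" if "t > 0" for t x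
  proof (rule has_vector_derivative_transform_within_open[where S = "{0<..}"])
    show "((\<lambda>t. moment a y 0 t x) has_vector_derivative Ut t x) (at t)"
      unfolding Ut_def M_def A_def B_def by (rule moment_deriv_t[OF a y that])
  qed (use that u in auto)
  have dt: "dt u t x = Ut t x" if "t > 0" for t x
    unfolding dt_def by (rule vector_derivative_at[OF d3[OF that]])
  have cM: "continuous_on ({0<..} \<times> UNIV) (\<lambda>p. M k (fst p) (snd p))" for k
    using continuous_on_moment[OF a y, of k] by (simp add: M_def case_prod_unfold)
  have cAB: "continuous_on ({0<..} \<times> UNIV) (\<lambda>p :: real \<times> real. A (fst p))"
    "continuous_on ({0<..} \<times> UNIV) (\<lambda>p :: real \<times> real. B (fst p))"
    unfolding A_def B_def
    by (auto intro!: continuous_on_compose2[OF continuous_on_osc(1)[OF a]]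
        continuous_on_compose2[OF continuous_on_osc(2)[OF a]] continuous_intros)
  have c0: "continuous_on ({0<..} \<times> UNIV) (\<lambda>(t, x). u t x)"
    using cM[of 0] by (rule continuous_on_eq) (auto simp: u')
  have "continuous_on ({0<..} \<times> UNIV) (\<lambda>p. U1 (fst p) (snd p))"
    unfolding U1_def by (intro continuous_intros cM cAB)
  then have c1: "continuous_on ({0<..} \<times> UNIV) (\<lambda>(t, x). dx (u t) x)"
    by (rule continuous_on_eq) (auto simp: dx1)
  have "continuous_on ({0<..} \<times> UNIV) (\<lambda>p. U2 (fst p) (snd p))"
    unfolding U2_def by (intro continuous_intros cM cAB)
  then have c2: "continuous_on ({0<..} \<times> UNIV) (\<lambda>(t, x). dx (dx (u t)) x)"
    by (rule continuous_on_eq) (auto simp: dx2)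
  have "continuous_on ({0<..} \<times> UNIV) (\<lambda>p. Ut (fst p) (snd p))"
    unfolding Ut_def by (intro continuous_intros cM cAB)
  then have ct: "continuous_on ({0<..} \<times> UNIV) (\<lambda>(t, x). dt u t x)"
    by (rule continuous_on_eq) (auto simp: dt)
  have diff: "(\<lambda>\<tau>. u \<tau> x) differentiable (at t)" "u t differentiable (at x)" "dx (u t) differentiable (at x)"
    if "t > 0" for t x
    using d1[OF that, of x] d2[OF that, of x] d3[OF that, of x]
    by (auto simp: dx1[OF that] intro: differentiableI_vector)
  show "C12 u"
    unfolding C12_def using diff c0 c1 c2 ct by blast
  show "harmonic_oscillator a (u t) x = dt u t x" if "t > 0" for t x
  proof -
    have "(A t)\<^sup>2 = (B t)\<^sup>2 + a\<^sup>2"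
      using osc_coth_sq[OF a that] by (simp add: A_def B_def)
    then have "(A t)\<^sup>2 * x\<^sup>2 - A t = ((B t)\<^sup>2 * x\<^sup>2 - A t) + a\<^sup>2 * x\<^sup>2"
      by (simp add: algebra_simps)
    then have "U2 t x = Ut t x + (a\<^sup>2 * x\<^sup>2) *\<^sub>R M 0 t x"
      unfolding U2_def Ut_def by (simp only: scaleR_add_left add.assoc)
    then show ?thesis
      unfolding harmonic_oscillator_def dx2[OF that] dt[OF that] unfolding u'[OF that] by simp
  qed
qed

section \<open>Contraction and continuity in mean square\<close>

lemma
  assumes a: "a > 0" and t: "t > 0"
  shows integrable_K: "integrable lebesgue (\<lambda>s. K a x s t)"
    and integral_K: "(\<integral>s. K a x s t \<partial>lebesgue) = osc_mass a t x"
    and nn_integral_K_le_1: "(\<integral>\<^sup>+s. ennreal (K a x s t) \<partial>lebesgue) \<le> 1"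
proof -
  define \<sigma> where "\<sigma> = sqrt (tanh (2 * a * t) / a)"
  define \<mu> where "\<mu> = x / cosh (2 * a * t)"
  have \<sigma>: "\<sigma> > 0" using a t by (simp add: \<sigma>_def)
  have eq: "K a x s t = osc_mass a t x * normal_density \<mu> \<sigma> s" for s
    unfolding \<sigma>_def \<mu>_def by (rule K_eq_normal_density[OF a t])
  show int: "integrable lebesgue (\<lambda>s. K a x s t)"
    unfolding eq by (subst integrable_completion) (use \<sigma> in auto)
  show I: "(\<integral>s. K a x s t \<partial>lebesgue) = osc_mass a t x"
    unfolding eq by (subst integral_completion) (use \<sigma> in auto)
  have "(\<integral>\<^sup>+s. ennreal (K a x s t) \<partial>lebesgue) = ennreal (\<integral>s. K a x s t \<partial>lebesgue)"
    by (intro nn_integral_eq_integral int AE_I2 less_imp_le K_pos a t)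
  then show "(\<integral>\<^sup>+s. ennreal (K a x s t) \<partial>lebesgue) \<le> 1"
    using osc_mass_bounds[OF a t, of x] by (simp add: I)
qed

lemma sigma_finite_lebesgue: "sigma_finite_measure (lebesgue :: real measure)"
proof -
  obtain A :: "real set set" where A: "countable A" "A \<subseteq> sets lborel" "\<Union>A = space lborel"
    "\<forall>X\<in>A. emeasure lborel X \<noteq> \<infinity>"
    using lborel.sigma_finite_countable by auto
  then show ?thesis
    by (intro sigma_finite_measure.intro exI[of _ A]) (auto simp: subset_iff)
qed

context
  fixes a :: real and y :: "real \<Rightarrow> complex"
  assumes a: "a > 0" and y: "square_integrable y"
begin

lemma continuous_on_moment_x:
  assumes "t > 0" shows "continuous_on S (moment a y k t)"
  using moment_deriv_x[OF a y assms, of k]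
  by (intro continuous_at_imp_continuous_on ballI) (auto intro: has_vector_derivative_continuous)

lemma moment_gaussian_bound:
  assumes t0: "t0 > 0"
  obtains D c where "D \<ge> 0" "c > 0" "\<And>t x. t0 \<le> t \<Longrightarrow> norm (moment a y 0 t x) \<le> D * exp (- (c * x\<^sup>2))"
proof -
  obtain C c where C: "C > 0" "c > 0"
    "\<And>t x s. t0 \<le> t \<Longrightarrow> K a x s t \<le> C * exp (- (c * x\<^sup>2)) * exp (- (c * s\<^sup>2))"
    using K_bound[OF a t0] by metis
  define I where "I = (\<integral>s. exp (- (c * s\<^sup>2)) * norm (y s) \<partial>lebesgue)"
  have int: "integrable lebesgue (\<lambda>s. exp (- (c * s\<^sup>2)) * norm (y s))"
    using integrable_poly_gaussian_mult[OF C(2) y, of 0] by simp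
  have "I \<ge> 0" unfolding I_def by simp
  show ?thesis
  proof (rule that)
    fix t x assume t: "t0 \<le> t"
    then have t': "t > 0" using t0 by linarith
    have "norm (moment a y 0 t x) \<le> (\<integral>s. norm ((s ^ 0 * K a x s t) *\<^sub>R y s) \<partial>lebesgue)"
      unfolding moment_def by (rule integral_norm_bound)
    also have "\<dots> \<le> (\<integral>s. C * exp (- (c * x\<^sup>2)) * (exp (- (c * s\<^sup>2)) * norm (y s)) \<partial>lebesgue)"
    proof (rule integral_mono)
      show "integrable lebesgue (\<lambda>s. norm ((s ^ 0 * K a x s t) *\<^sub>R y s))"
        by (intro integrable_norm integrable_moment[OF a y t'])
      show "integrable lebesgue (\<lambda>s. C * exp (- (c * x\<^sup>2)) * (exp (- (c * s\<^sup>2)) * norm (y s)))"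
        by (intro integrable_mult_right int)
      fix s
      have "\<bar>K a x s t\<bar> \<le> C * exp (- (c * x\<^sup>2)) * exp (- (c * s\<^sup>2))"
        using C(3)[OF t] K_pos[OF a t', of x s] by simp
      from mult_right_mono[OF this, of "norm (y s)"]
      show "norm ((s ^ 0 * K a x s t) *\<^sub>R y s) \<le> C * exp (- (c * x\<^sup>2)) * (exp (- (c * s\<^sup>2)) * norm (y s))"
        by (simp add: mult.assoc)
    qed
    also have "\<dots> = C * exp (- (c * x\<^sup>2)) * I" by (simp add: I_def)
    finally show "norm (moment a y 0 t x) \<le> C * I * exp (- (c * x\<^sup>2))" by (simp add: mult_ac)
  qed (use C \<open>I \<ge> 0\<close> in auto)
qed

lemma measurable_moment:
  assumes "t > 0" shows "moment a y k t \<in> borel_measurable lebesgue"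
  using continuous_on_moment_x[OF assms, of UNIV k]
  by (intro measurable_completion) (simp add: borel_measurable_continuous_onI)

lemma square_integrable_moment:
  assumes t: "t > 0"
  shows "square_integrable (moment a y 0 t)"
proof -
  obtain D c where D: "D \<ge> 0" "c > 0" "\<And>\<tau> x. t \<le> \<tau> \<Longrightarrow> norm (moment a y 0 \<tau> x) \<le> D * exp (- (c * x\<^sup>2))"
    using moment_gaussian_bound[OF t] by metis
  show ?thesis
  proof (rule square_integrable_bound[OF measurable_moment[OF t]])
    show "integrable lebesgue (\<lambda>x. D\<^sup>2 * exp (- (2 * c * x\<^sup>2)))"
      by (intro integrable_mult_right integrable_gaussian) (use D in auto)
    fix x
    have "(norm (moment a y 0 t x))\<^sup>2 \<le> (D * exp (- (c * x\<^sup>2)))\<^sup>2"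
      by (intro power_mono D) auto
    also have "\<dots> = D\<^sup>2 * exp (- (2 * c * x\<^sup>2))"
      by (simp add: power_mult_distrib exp_double[symmetric] mult.assoc)
    finally show "(norm (moment a y 0 t x))\<^sup>2 \<le> D\<^sup>2 * exp (- (2 * c * x\<^sup>2))" .
  qed
qed

text \<open>Jensen's inequality for the measure \<open>K(x, s, t) ds\<close> of mass at most \<open>1\<close>: with
  \<open>c = \<integral> K |y|\<close>, expand \<open>0 \<le> \<integral> K (|y| - c)\<^sup>2 \<le> \<integral> K |y|\<^sup>2 - c\<^sup>2\<close>.\<close>

lemma norm_moment_sq_le:
  assumes t: "t > 0"
  shows "integrable lebesgue (\<lambda>s. K a x s t * (norm (y s))\<^sup>2)"
    "(norm (moment a y 0 t x))\<^sup>2 \<le> (\<integral>s. K a x s t * (norm (y s))\<^sup>2 \<partial>lebesgue)"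
proof -
  note [measurable] = square_integrable_measurable[OF y]
  define c where "c = (\<integral>s. K a x s t * norm (y s) \<partial>lebesgue)"
  have K0: "K a x s t \<ge> 0" for s using K_pos[OF a t, of x s] by simp
  obtain C e where C: "C > 0" "e > 0"
    "\<And>\<tau> x s. t \<le> \<tau> \<Longrightarrow> K a x s \<tau> \<le> C * exp (- (e * x\<^sup>2)) * exp (- (e * s\<^sup>2))"
    using K_bound[OF a t] by metis
  have KC: "K a x s t \<le> C" for s
  proof -
    have "K a x s t \<le> C * exp (- (e * x\<^sup>2)) * exp (- (e * s\<^sup>2))" by (rule C(3)) simp
    also have "\<dots> \<le> C * 1 * 1" using C by (intro mult_mono) auto
    finally show ?thesis by simp
  qed
  have i1: "integrable lebesgue (\<lambda>s. K a x s t * norm (y s))"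
    using integrable_norm[OF integrable_moment[OF a y t, of 0 x]] K0 by simp
  show i2: "integrable lebesgue (\<lambda>s. K a x s t * (norm (y s))\<^sup>2)"
  proof (rule Bochner_Integration.integrable_bound)
    show "integrable lebesgue (\<lambda>s. C * (norm (y s))\<^sup>2)"
      using y by (auto simp: square_integrable_def)
  qed (use K0 KC C in \<open>auto intro!: mult_right_mono\<close>)
  have i0: "integrable lebesgue (\<lambda>s. K a x s t)" by (rule integrable_K[OF a t])
  have "norm (moment a y 0 t x) \<le> (\<integral>s. norm ((s ^ 0 * K a x s t) *\<^sub>R y s) \<partial>lebesgue)"
    unfolding moment_def by (rule integral_norm_bound)
  then have le: "norm (moment a y 0 t x) \<le> c" using K0 by (simp add: c_def)
  have "0 \<le> (\<integral>s. K a x s t * (norm (y s) - c)\<^sup>2 \<partial>lebesgue)"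
    using K0 by (intro integral_nonneg_AE) auto
  also have "\<dots> = (\<integral>s. K a x s t * (norm (y s))\<^sup>2 - 2 * c * (K a x s t * norm (y s)) + c\<^sup>2 * K a x s t \<partial>lebesgue)"
    by (simp add: power2_diff algebra_simps)
  also have "\<dots> = (\<integral>s. K a x s t * (norm (y s))\<^sup>2 \<partial>lebesgue) - 2 * c * c + c\<^sup>2 * osc_mass a t x"
    using i0 i1 i2 by (simp add: c_def integral_K[OF a t])
  also have "\<dots> \<le> (\<integral>s. K a x s t * (norm (y s))\<^sup>2 \<partial>lebesgue) - 2 * c * c + c\<^sup>2 * 1"
    by (intro add_left_mono mult_left_mono osc_mass_bounds[OF a t]) auto
  finally have "c\<^sup>2 \<le> (\<integral>s. K a x s t * (norm (y s))\<^sup>2 \<partial>lebesgue)" by (simp add: power2_eq_square)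
  moreover have "(norm (moment a y 0 t x))\<^sup>2 \<le> c\<^sup>2" using le by (intro power_mono) auto
  ultimately show "(norm (moment a y 0 t x))\<^sup>2 \<le> (\<integral>s. K a x s t * (norm (y s))\<^sup>2 \<partial>lebesgue)"
    by linarith
qed

text \<open>Integrate the previous bound over \<open>x\<close>, exchange the integrals, and use that by symmetry
  \<open>K\<close> has mass at most \<open>1\<close> in \<open>x\<close> as well.\<close>

lemma L2sq_moment_le:
  assumes t: "t > 0"
  shows "L2sq (moment a y 0 t) \<le> L2sq y"
proof -
  note [measurable] = square_integrable_measurable[OF y]
  interpret sigma_finite_measure "lebesgue :: real measure" by (rule sigma_finite_lebesgue)
  interpret pair_sigma_finite "lebesgue :: real measure" "lebesgue :: real measure" ..
  have K0: "K a x s t \<ge> 0" for x s using K_pos[OF a t, of x s] by simp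
  have nn: "(\<integral>\<^sup>+x. ennreal ((norm (f x))\<^sup>2) \<partial>lebesgue) = ennreal (L2sq f)" if "square_integrable f" for f
    using that unfolding L2sq_def by (intro nn_integral_eq_integral) (auto simp: square_integrable_def)
  have "ennreal (L2sq (moment a y 0 t)) = (\<integral>\<^sup>+x. ennreal ((norm (moment a y 0 t x))\<^sup>2) \<partial>lebesgue)"
    by (rule nn[OF square_integrable_moment[OF t], symmetric])
  also have "\<dots> \<le> (\<integral>\<^sup>+x. \<integral>\<^sup>+s. ennreal (K a x s t * (norm (y s))\<^sup>2) \<partial>lebesgue \<partial>lebesgue)"
  proof (rule nn_integral_mono)
    fix x
    have "(\<integral>\<^sup>+s. ennreal (K a x s t * (norm (y s))\<^sup>2) \<partial>lebesgue)
        = ennreal (\<integral>s. K a x s t * (norm (y s))\<^sup>2 \<partial>lebesgue)"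
      using K0 by (intro nn_integral_eq_integral norm_moment_sq_le t) auto
    then show "ennreal ((norm (moment a y 0 t x))\<^sup>2) \<le> (\<integral>\<^sup>+s. ennreal (K a x s t * (norm (y s))\<^sup>2) \<partial>lebesgue)"
      using norm_moment_sq_le(2)[OF t, of x] by (simp add: ennreal_leI)
  qed
  also have "\<dots> = (\<integral>\<^sup>+s. \<integral>\<^sup>+x. ennreal (K a x s t * (norm (y s))\<^sup>2) \<partial>lebesgue \<partial>lebesgue)"
    by (rule Fubini'[symmetric]) (unfold K_def, measurable)
  also have "\<dots> \<le> (\<integral>\<^sup>+s. ennreal ((norm (y s))\<^sup>2) \<partial>lebesgue)"
  proof (rule nn_integral_mono)
    fix s
    have [measurable]: "(\<lambda>x. K a x s t) \<in> borel_measurable lebesgue" unfolding K_def by measurable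
    have "(\<integral>\<^sup>+x. ennreal (K a x s t * (norm (y s))\<^sup>2) \<partial>lebesgue)
        = (\<integral>\<^sup>+x. ennreal (K a x s t) \<partial>lebesgue) * ennreal ((norm (y s))\<^sup>2)"
      using K0 by (simp add: ennreal_mult nn_integral_multc)
    also have "\<dots> \<le> 1 * ennreal ((norm (y s))\<^sup>2)"
      using nn_integral_K_le_1[OF a t, of s] unfolding K_commute[OF a t, of _ s]
      by (intro mult_right_mono) auto
    finally show "(\<integral>\<^sup>+x. ennreal (K a x s t * (norm (y s))\<^sup>2) \<partial>lebesgue) \<le> ennreal ((norm (y s))\<^sup>2)"
      by simp
  qed
  also have "\<dots> = ennreal (L2sq y)" by (rule nn[OF y])
  finally show ?thesis by (simp add: ennreal_le_iff L2sq_nonneg)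
qed

lemma moment_L2_continuous_at:
  assumes t: "t > 0"
  shows "((\<lambda>\<tau>. L2sq (\<lambda>x. moment a y 0 \<tau> x - moment a y 0 t x)) \<longlongrightarrow> 0) (at t within S)"
proof -
  define t0 where "t0 = t / 2"
  have t0: "t0 > 0" "t0 < t" using t by (auto simp: t0_def)
  obtain D c where D: "D \<ge> 0" "c > 0" "\<And>\<tau> x. t0 \<le> \<tau> \<Longrightarrow> norm (moment a y 0 \<tau> x) \<le> D * exp (- (c * x\<^sup>2))"
    using moment_gaussian_bound[OF t0(1)] by metis
  have near: "\<forall>\<^sub>F \<tau> in at t within S. t0 < \<tau>"
    using t0 by (intro order_tendstoD(1)[where y = t] tendsto_ident_at)
  have "((\<lambda>\<tau>. L2sq (\<lambda>x. moment a y 0 \<tau> x - moment a y 0 t x)) \<longlongrightarrow> (\<integral>x. 0 \<partial>(lebesgue :: real measure))) (at t within S)"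
    unfolding L2sq_def
  proof (rule tendsto_integral_dominated)
    show "integrable lebesgue (\<lambda>x. (2 * D)\<^sup>2 * exp (- (2 * c * x\<^sup>2)))"
      by (intro integrable_mult_right integrable_gaussian) (use D in auto)
    show "\<forall>\<^sub>F \<tau> in at t within S. (\<lambda>x. (norm (moment a y 0 \<tau> x - moment a y 0 t x))\<^sup>2) \<in> borel_measurable lebesgue"
      using near
    proof eventually_elim
      case (elim \<tau>)
      then have [measurable]: "moment a y 0 \<tau> \<in> borel_measurable lebesgue" "moment a y 0 t \<in> borel_measurable lebesgue"
        using t t0 by (auto intro: measurable_moment)
      show ?case by measurable
    qed
    show "\<forall>\<^sub>F \<tau> in at t within S. \<forall>x. norm ((norm (moment a y 0 \<tau> x - moment a y 0 t x))\<^sup>2)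
        \<le> (2 * D)\<^sup>2 * exp (- (2 * c * x\<^sup>2))"
      using near
    proof eventually_elim
      case (elim \<tau>)
      show ?case
      proof
        fix x
        have "norm (moment a y 0 \<tau> x - moment a y 0 t x) \<le> D * exp (- (c * x\<^sup>2)) + D * exp (- (c * x\<^sup>2))"
          using elim t0 by (intro order_trans[OF norm_triangle_ineq4] add_mono D) auto
        then have "(norm (moment a y 0 \<tau> x - moment a y 0 t x))\<^sup>2 \<le> (2 * D * exp (- (c * x\<^sup>2)))\<^sup>2"
          by (intro power_mono) auto
        also have "\<dots> = (2 * D)\<^sup>2 * exp (- (2 * c * x\<^sup>2))"
          by (simp add: power_mult_distrib exp_double[symmetric] mult.assoc)
        finally show "norm ((norm (moment a y 0 \<tau> x - moment a y 0 t x))\<^sup>2)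
          \<le> (2 * D)\<^sup>2 * exp (- (2 * c * x\<^sup>2))" by simp
      qed
    qed
    fix x
    have "isCont (\<lambda>t. moment a y 0 t x) t"
      using moment_deriv_t[OF a y t] by (rule has_vector_derivative_continuous)
    then have "((\<lambda>\<tau>. moment a y 0 \<tau> x) \<longlongrightarrow> moment a y 0 t x) (at t within S)"
      by (auto simp: isCont_def intro: tendsto_within_subset)
    then have "((\<lambda>\<tau>. (norm (moment a y 0 \<tau> x - moment a y 0 t x))\<^sup>2) \<longlongrightarrow>
        (norm (moment a y 0 t x - moment a y 0 t x))\<^sup>2) (at t within S)"
      by (intro tendsto_intros)
    then show "((\<lambda>\<tau>. (norm (moment a y 0 \<tau> x - moment a y 0 t x))\<^sup>2) \<longlongrightarrow> 0) (at t within S)" by simp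
  qed simp
  then show ?thesis by simp
qed

end

section \<open>Attainment of the initial datum\<close>

lemma moment_diff:
  assumes "a > 0" "t > 0" "square_integrable f" "square_integrable g"
  shows "moment a (\<lambda>s. f s - g s) k t x = moment a f k t x - moment a g k t x"
  unfolding moment_def scaleR_diff_right
  by (intro Bochner_Integration.integral_diff integrable_moment assms)

lemma norm_moment_le_bound:
  assumes a: "a > 0" and t: "t > 0" and f: "square_integrable f" "\<And>x. norm (f x) \<le> C"
  shows "norm (moment a f 0 t x) \<le> C"
proof -
  have K0: "K a x s t \<ge> 0" for s using K_pos[OF a t, of x s] by simp
  have "C \<ge> 0" using f(2)[of 0] norm_ge_zero[of "f 0"] by linarith
  have "norm (moment a f 0 t x) \<le> (\<integral>s. norm ((s ^ 0 * K a x s t) *\<^sub>R f s) \<partial>lebesgue)"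
    unfolding moment_def by (rule integral_norm_bound)
  also have "\<dots> \<le> (\<integral>s. K a x s t * C \<partial>lebesgue)"
  proof (rule integral_mono)
    show "integrable lebesgue (\<lambda>s. norm ((s ^ 0 * K a x s t) *\<^sub>R f s))"
      by (intro integrable_norm integrable_moment a t f)
    show "integrable lebesgue (\<lambda>s. K a x s t * C)"
      by (intro integrable_mult_left integrable_K a t)
    show "norm ((s ^ 0 * K a x s t) *\<^sub>R f s) \<le> K a x s t * C" for s
      using K0 f(2) by (auto intro: mult_left_mono)
  qed
  also have "\<dots> = osc_mass a t x * C" by (simp add: integral_K[OF a t])
  also have "\<dots> \<le> C" using osc_mass_bounds[OF a t] \<open>C \<ge> 0\<close> by (intro mult_left_le_one_le)
  finally show ?thesis .
qed

text \<open>The substitution \<open>s = \<mu> + \<sigma> z\<close> turns the integral into the mass times the expectation of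
  \<open>f (\<mu> + \<sigma> Z)\<close> for a standard normal \<open>Z\<close>, where the mass, \<open>\<mu>\<close> and \<open>\<sigma>\<close> tend to \<open>1\<close>, \<open>x\<close> and \<open>0\<close>.\<close>

lemma moment_tendsto_initial:
  assumes a: "a > 0" and f: "continuous_on UNIV f" "\<And>x. norm (f x) \<le> C"
  shows "((\<lambda>t. moment a f 0 t x) \<longlongrightarrow> f x) (at_right 0)"
proof -
  define \<sigma> where "\<sigma> t = sqrt (tanh (2 * a * t) / a)" for t
  define \<mu> where "\<mu> t = x / cosh (2 * a * t)" for t
  have fm [measurable]: "f \<in> borel_measurable borel"
    using f(1) by (rule borel_measurable_continuous_onI)
  have pos: "\<forall>\<^sub>F t in at_right (0::real). 0 < t" by (simp add: eventually_at_filter)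
  have eq: "osc_mass a t x *\<^sub>R (\<integral>z. std_normal_density z *\<^sub>R f (\<mu> t + \<sigma> t * z) \<partial>lborel) = moment a f 0 t x"
    if t: "t > 0" for t
  proof -
    have \<sigma>: "\<sigma> t > 0" using a t by (simp add: \<sigma>_def)
    have "moment a f 0 t x = (\<integral>s. (osc_mass a t x * normal_density (\<mu> t) (\<sigma> t) s) *\<^sub>R f s \<partial>lebesgue)"
      by (simp add: moment_def K_eq_normal_density[OF a t] \<mu>_def \<sigma>_def)
    also have "\<dots> = (\<integral>s. (osc_mass a t x * normal_density (\<mu> t) (\<sigma> t) s) *\<^sub>R f s \<partial>lborel)"
      using fm by (intro integral_completion borel_measurable_scaleR borel_measurable_times) auto
    also have "\<dots> = osc_mass a t x *\<^sub>R (\<integral>s. normal_density (\<mu> t) (\<sigma> t) s *\<^sub>R f s \<partial>lborel)"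
      by (simp flip: scaleR_scaleR)
    also have "(\<integral>s. normal_density (\<mu> t) (\<sigma> t) s *\<^sub>R f s \<partial>lborel)
        = \<bar>\<sigma> t\<bar> *\<^sub>R (\<integral>z. normal_density (\<mu> t) (\<sigma> t) (\<mu> t + \<sigma> t * z) *\<^sub>R f (\<mu> t + \<sigma> t * z) \<partial>lborel)"
      using \<sigma> by (intro lborel_integral_real_affine) auto
    also have "\<dots> = (\<integral>z. (\<bar>\<sigma> t\<bar> * normal_density (\<mu> t) (\<sigma> t) (\<mu> t + \<sigma> t * z)) *\<^sub>R f (\<mu> t + \<sigma> t * z) \<partial>lborel)"
      by (simp flip: scaleR_scaleR)
    also have "(\<lambda>z. \<bar>\<sigma> t\<bar> * normal_density (\<mu> t) (\<sigma> t) (\<mu> t + \<sigma> t * z)) = std_normal_density"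
      using \<sigma> by (auto simp: fun_eq_iff normal_density_def real_sqrt_mult power_mult_distrib)
    finally show ?thesis by simp
  qed
  have l\<mu>: "(\<mu> \<longlongrightarrow> x) (at_right 0)" unfolding \<mu>_def[abs_def]
    by (rule tendsto_eq_intros refl | simp)+
  have l\<sigma>: "(\<sigma> \<longlongrightarrow> 0) (at_right 0)" unfolding \<sigma>_def[abs_def]
    using a by (auto intro!: tendsto_eq_intros)
  have lm: "((\<lambda>t. osc_mass a t x) \<longlongrightarrow> 1) (at_right 0)" unfolding osc_mass_def
    by (rule tendsto_eq_intros refl | simp)+
  have "((\<lambda>t. \<integral>z. std_normal_density z *\<^sub>R f (\<mu> t + \<sigma> t * z) \<partial>lborel)
      \<longlongrightarrow> (\<integral>z. std_normal_density z *\<^sub>R f x \<partial>lborel)) (at_right 0)"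
  proof (rule tendsto_integral_dominated)
    show "integrable lborel (\<lambda>z. std_normal_density z * C)" by auto
    show "\<forall>\<^sub>F t in at_right 0. \<forall>z. norm (std_normal_density z *\<^sub>R f (\<mu> t + \<sigma> t * z)) \<le> std_normal_density z * C"
      using f(2) by (auto intro!: always_eventually mult_left_mono)
    fix z
    have "isCont f x" using f(1) by (simp add: continuous_on_eq_continuous_at)
    moreover have "((\<lambda>t. \<mu> t + \<sigma> t * z) \<longlongrightarrow> x + 0 * z) (at_right 0)"
      by (intro tendsto_intros l\<mu> l\<sigma>)
    then have "((\<lambda>t. \<mu> t + \<sigma> t * z) \<longlongrightarrow> x) (at_right 0)" by simp
    ultimately have "((\<lambda>t. f (\<mu> t + \<sigma> t * z)) \<longlongrightarrow> f x) (at_right 0)"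
      by (rule isCont_tendsto_compose)
    then show "((\<lambda>t. std_normal_density z *\<^sub>R f (\<mu> t + \<sigma> t * z)) \<longlongrightarrow> std_normal_density z *\<^sub>R f x) (at_right 0)"
      by (intro tendsto_intros)
  qed auto
  then have "((\<lambda>t. osc_mass a t x *\<^sub>R (\<integral>z. std_normal_density z *\<^sub>R f (\<mu> t + \<sigma> t * z) \<partial>lborel))
      \<longlongrightarrow> 1 *\<^sub>R (\<integral>z. std_normal_density z *\<^sub>R f x \<partial>lborel)) (at_right 0)"
    by (intro tendsto_intros lm)
  then have "((\<lambda>t. osc_mass a t x *\<^sub>R (\<integral>z. std_normal_density z *\<^sub>R f (\<mu> t + \<sigma> t * z) \<partial>lborel)) \<longlongrightarrow> f x) (at_right 0)"
    by simp
  then show ?thesis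
    by (rule Lim_transform_eventually) (use pos in \<open>eventually_elim, simp add: eq\<close>)
qed

text \<open>Since \<open>T\<^sub>t\<close> is a contraction, \<open>\<parallel>T\<^sub>t f - f\<parallel>\<^sup>2 \<le> 2\<parallel>f\<parallel>\<^sup>2 - 2\<langle>T\<^sub>t f, f\<rangle>\<close>; the inner product converges
  by domination with \<open>C |f|\<close>.\<close>

lemma moment_L2_initial_bounded_continuous:
  assumes a: "a > 0" and f: "continuous_on UNIV f" "\<And>x. norm (f x) \<le> C" "integrable lebesgue f"
    and sq: "square_integrable f"
  shows "((\<lambda>t. L2sq (\<lambda>x. moment a f 0 t x - f x)) \<longlongrightarrow> 0) (at_right 0)"
proof -
  have [measurable]: "f \<in> borel_measurable lebesgue" using sq by (simp add: square_integrable_def)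
  have pos: "\<forall>\<^sub>F t in at_right (0::real). 0 < t" by (simp add: eventually_at_filter)
  define P where "P t = (\<integral>x. moment a f 0 t x \<bullet> f x \<partial>lebesgue)" for t
  have bound: "norm (moment a f 0 t x \<bullet> f x) \<le> C * norm (f x)" if "t > 0" for t x
    using norm_moment_le_bound[OF a that sq f(2), of x] Cauchy_Schwarz_ineq2[of "moment a f 0 t x" "f x"]
      mult_right_mono[of "norm (moment a f 0 t x)" C "norm (f x)"] by auto
  have "(P \<longlongrightarrow> (\<integral>x. f x \<bullet> f x \<partial>lebesgue)) (at_right 0)"
    unfolding P_def[abs_def]
  proof (rule tendsto_integral_dominated)
    show "integrable lebesgue (\<lambda>x. C * norm (f x))" using f(3) by auto
    show "\<forall>\<^sub>F t in at_right 0. (\<lambda>x. moment a f 0 t x \<bullet> f x) \<in> borel_measurable lebesgue"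
      using pos
    proof eventually_elim
      case (elim t)
      have [measurable]: "moment a f 0 t \<in> borel_measurable lebesgue" by (rule measurable_moment[OF a sq elim])
      show ?case by measurable
    qed
    show "\<forall>\<^sub>F t in at_right 0. \<forall>x. norm (moment a f 0 t x \<bullet> f x) \<le> C * norm (f x)"
      using pos by eventually_elim (use bound in blast)
    show "((\<lambda>t. moment a f 0 t x \<bullet> f x) \<longlongrightarrow> f x \<bullet> f x) (at_right 0)" for x
      by (intro tendsto_intros moment_tendsto_initial[OF a f(1,2)])
  qed measurable
  then have P: "(P \<longlongrightarrow> L2sq f) (at_right 0)" by (simp add: L2sq_def power2_norm_eq_inner)
  have "((\<lambda>t. 2 * L2sq f - 2 * P t) \<longlongrightarrow> 2 * L2sq f - 2 * L2sq f) (at_right 0)"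
    by (intro tendsto_intros P)
  then have lim: "((\<lambda>t. 2 * L2sq f - 2 * P t) \<longlongrightarrow> 0) (at_right 0)" by simp
  show ?thesis
  proof (rule tendsto_sandwich[OF _ _ tendsto_const lim])
    show "\<forall>\<^sub>F t in at_right 0. L2sq (\<lambda>x. moment a f 0 t x - f x) \<le> 2 * L2sq f - 2 * P t"
      using pos
    proof eventually_elim
      case (elim t)
      have [measurable]: "moment a f 0 t \<in> borel_measurable lebesgue" by (rule measurable_moment[OF a sq elim])
      have i1: "integrable lebesgue (\<lambda>x. (norm (moment a f 0 t x))\<^sup>2)"
        using square_integrable_moment[OF a sq elim] by (simp add: square_integrable_def)
      have i2: "integrable lebesgue (\<lambda>x. (norm (f x))\<^sup>2)"
        using sq by (simp add: square_integrable_def)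
      have i3: "integrable lebesgue (\<lambda>x. moment a f 0 t x \<bullet> f x)"
      proof (rule Bochner_Integration.integrable_bound)
        show "integrable lebesgue (\<lambda>x. C * norm (f x))" using f(3) by auto
        show "AE x in lebesgue. norm (moment a f 0 t x \<bullet> f x) \<le> norm (C * norm (f x))"
          by (intro AE_I2 order_trans[OF bound[OF elim]]) (unfold real_norm_def, rule abs_ge_self)
      qed measurable
      have "L2sq (\<lambda>x. moment a f 0 t x - f x)
          = (\<integral>x. (norm (moment a f 0 t x))\<^sup>2 + (norm (f x))\<^sup>2 - 2 * (moment a f 0 t x \<bullet> f x) \<partial>lebesgue)"
        unfolding L2sq_def
        by (simp add: power2_norm_eq_inner inner_diff_left inner_diff_right inner_commute algebra_simps)
      also have "\<dots> = L2sq (moment a f 0 t) + L2sq f - 2 * P t"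
        using i1 i2 i3 by (simp add: L2sq_def P_def)
      also have "\<dots> \<le> 2 * L2sq f - 2 * P t"
        using L2sq_moment_le[OF a sq elim] by simp
      finally show ?case .
    qed
  qed (simp add: L2sq_nonneg)
qed

lemma L2_truncation:
  assumes y: "square_integrable y" and e: "e > 0"
  obtains h n where "h \<in> borel_measurable lebesgue" "n > 0" "\<And>x. norm (h x) \<le> n"
    "\<And>x. \<bar>x\<bar> > n \<Longrightarrow> h x = 0" "square_integrable h" "L2sq (\<lambda>x. y x - h x) < e"
proof -
  have [measurable]: "y \<in> borel_measurable lebesgue" and i: "integrable lebesgue (\<lambda>x. (norm (y x))\<^sup>2)"
    using y by (auto simp: square_integrable_def)
  define h where "h n x = (if \<bar>x\<bar> \<le> real (Suc n) \<and> norm (y x) \<le> real (Suc n) then y x else 0)" for n x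
  have [measurable]: "h n \<in> borel_measurable lebesgue" for n unfolding h_def by measurable
  have "(\<lambda>n. L2sq (\<lambda>x. y x - h n x)) \<longlonglongrightarrow> (\<integral>x. 0 \<partial>(lebesgue :: real measure))"
    unfolding L2sq_def
  proof (rule integral_dominated_convergence[OF _ _ i])
    show "AE x in lebesgue. (\<lambda>n. (norm (y x - h n x))\<^sup>2) \<longlonglongrightarrow> 0"
    proof (rule AE_I2)
      fix x
      obtain N where N: "max \<bar>x\<bar> (norm (y x)) \<le> real N" using real_arch_simple by blast
      have "\<forall>\<^sub>F n in sequentially. (norm (y x - h n x))\<^sup>2 = 0"
        using N by (intro eventually_sequentiallyI[of N]) (auto simp: h_def)
      then show "(\<lambda>n. (norm (y x - h n x))\<^sup>2) \<longlonglongrightarrow> 0" by (rule tendsto_eventually)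
    qed
    show "AE x in lebesgue. norm ((norm (y x - h n x))\<^sup>2) \<le> (norm (y x))\<^sup>2" for n
      by (intro AE_I2) (auto simp: h_def)
  qed measurable
  then have "(\<lambda>n. L2sq (\<lambda>x. y x - h n x)) \<longlonglongrightarrow> 0" by simp
  from order_tendstoD(2)[OF this e] obtain n where n: "L2sq (\<lambda>x. y x - h n x) < e"
    by (auto simp: eventually_sequentially)
  show ?thesis
  proof (rule that[of "h n" "real (Suc n)"])
    show "square_integrable (h n)"
      by (rule square_integrable_bound[OF _ i]) (auto simp: h_def)
  qed (use n in \<open>auto simp: h_def\<close>)
qed

text \<open>A bounded measurable function of bounded support is an almost everywhere limit of continuous
  functions; radial clipping and a continuous cutoff make these dominated.\<close>

lemma L2_dense_continuous:
  assumes y: "square_integrable y" and e: "e > 0"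
  obtains g C where "continuous_on UNIV g" "\<And>x. norm (g x) \<le> C" "integrable lebesgue g"
    "square_integrable g" "L2sq (\<lambda>x. y x - g x) < e"
proof -
  obtain h n where h: "h \<in> borel_measurable lebesgue" "n > 0" "\<And>x. norm (h x) \<le> n"
    "\<And>x. \<bar>x\<bar> > n \<Longrightarrow> h x = 0" "square_integrable h" "L2sq (\<lambda>x. y x - h x) < e / 4"
    using e by (rule_tac L2_truncation[OF y, of "e / 4"]) auto
  note [measurable] = h(1)
  have "h measurable_on UNIV" using h(1) by (intro lebesgue_measurable_imp_measurable_on) auto
  then obtain N g where N: "negligible N" "\<And>k. continuous_on UNIV (g k)"
    "\<And>x. x \<notin> N \<Longrightarrow> (\<lambda>k. g k x) \<longlonglongrightarrow> h x"
    unfolding measurable_on_def by auto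
  define clip where "clip z = (n / max n (norm z)) *\<^sub>R z" for z :: complex
  define \<eta> where "\<eta> x = max 0 (min 1 (n + 1 - \<bar>x\<bar>))" for x :: real
  define G where "G k x = \<eta> x *\<^sub>R clip (g k x)" for k x
  have clip_le: "norm (clip z) \<le> n" for z
    using h(2) by (cases "norm z \<le> n") (auto simp: clip_def)
  have clip_id: "clip z = z" if "norm z \<le> n" for z
    using h(2) that by (simp add: clip_def max_absorb1)
  have clip_cont: "continuous_on UNIV clip"
    unfolding clip_def using h(2) by (intro continuous_intros) auto
  have \<eta>: "0 \<le> \<eta> x" "\<eta> x \<le> 1" "\<bar>x\<bar> > n + 1 \<Longrightarrow> \<eta> x = 0" "\<bar>x\<bar> \<le> n \<Longrightarrow> \<eta> x = 1" for x
    by (auto simp: \<eta>_def)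
  have \<eta>_cont: "continuous_on UNIV \<eta>" unfolding \<eta>_def by (intro continuous_intros)
  have Gcont: "continuous_on UNIV (G k)" for k
    unfolding G_def by (intro continuous_intros \<eta>_cont continuous_on_compose2[OF clip_cont N(2)]) auto
  have [measurable]: "G k \<in> borel_measurable lebesgue" for k
    using Gcont[of k] by (intro measurable_completion) (simp add: borel_measurable_continuous_onI)
  have Gle: "norm (G k x) \<le> n * indicator {-(n+1)..n+1} x" for k x
  proof (cases "\<bar>x\<bar> > n + 1")
    case True
    then show ?thesis using h(2) \<eta>(3) by (simp add: G_def)
  next
    case False
    have "norm (G k x) \<le> 1 * n"
      unfolding G_def norm_scaleR using \<eta>[of x] clip_le by (intro mult_mono) auto
    then show ?thesis using False by (auto simp: indicator_def)
  qed
  have ind: "integrable lebesgue (indicator {-(n+1)..n+1} :: real \<Rightarrow> real)"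
    by (rule integrable_real_indicator) (auto simp: emeasure_lborel_Icc_eq)
  have Gint: "integrable lebesgue (G k)" for k
    by (rule Bochner_Integration.integrable_bound[OF integrable_mult_right[OF ind, of n]])
      (use Gle h(2) in auto)
  have Gsq: "square_integrable (G k)" for k
  proof (rule square_integrable_bound[OF _ integrable_mult_right[OF ind, of "n\<^sup>2"]])
    fix x
    have "(norm (G k x))\<^sup>2 \<le> (n * indicator {-(n+1)..n+1} x)\<^sup>2" by (intro power_mono Gle) auto
    then show "(norm (G k x))\<^sup>2 \<le> n\<^sup>2 * indicator {-(n+1)..n+1} x" by (auto simp: indicator_def)
  qed measurable
  have "(\<lambda>k. L2sq (\<lambda>x. h x - G k x)) \<longlonglongrightarrow> (\<integral>x. 0 \<partial>(lebesgue :: real measure))"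
    unfolding L2sq_def
  proof (rule integral_dominated_convergence[OF _ _ integrable_mult_right[OF ind, of "(2 * n)\<^sup>2"]])
    have "AE x in lebesgue. x \<notin> N"
      using N(1) by (simp add: negligible_iff_null_sets AE_not_in)
    then show "AE x in lebesgue. (\<lambda>k. (norm (h x - G k x))\<^sup>2) \<longlonglongrightarrow> 0"
    proof eventually_elim
      case (elim x)
      have "isCont clip (h x)" using clip_cont by (simp add: continuous_on_eq_continuous_at)
      then have "(\<lambda>k. clip (g k x)) \<longlonglongrightarrow> clip (h x)"
        using N(3)[OF elim] by (rule isCont_tendsto_compose)
      then have "(\<lambda>k. (norm (h x - \<eta> x *\<^sub>R clip (g k x)))\<^sup>2) \<longlonglongrightarrow> (norm (h x - \<eta> x *\<^sub>R clip (h x)))\<^sup>2"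
        by (intro tendsto_intros)
      moreover have "\<eta> x *\<^sub>R clip (h x) = h x"
        using \<eta>(4)[of x] h(4)[of x] clip_id[OF h(3), of x] by (cases "\<bar>x\<bar> \<le> n") auto
      ultimately show ?case by (simp add: G_def)
    qed
    show "AE x in lebesgue. norm ((norm (h x - G k x))\<^sup>2) \<le> (2 * n)\<^sup>2 * indicator {-(n+1)..n+1} x" for k
    proof (rule AE_I2)
      fix x
      have "norm (h x) \<le> n * indicator {-(n+1)..n+1} x"
        using h(3)[of x] h(4)[of x] by (auto simp: indicator_def)
      then have "norm (h x - G k x) \<le> 2 * n * indicator {-(n+1)..n+1} x"
        using Gle[of k x] norm_triangle_ineq4[of "h x" "G k x"] by linarith
      then have "(norm (h x - G k x))\<^sup>2 \<le> (2 * n * indicator {-(n+1)..n+1} x)\<^sup>2"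
        by (intro power_mono) auto
      then show "norm ((norm (h x - G k x))\<^sup>2) \<le> (2 * n)\<^sup>2 * indicator {-(n+1)..n+1} x"
        by (auto simp: indicator_def)
    qed
  qed measurable
  then have "(\<lambda>k. L2sq (\<lambda>x. h x - G k x)) \<longlonglongrightarrow> 0" by simp
  from order_tendstoD(2)[OF this, of "e / 4"] e obtain k where k: "L2sq (\<lambda>x. h x - G k x) < e / 4"
    by (auto simp: eventually_sequentially)
  show ?thesis
  proof (rule that[OF Gcont _ Gint Gsq])
    show "norm (G k x) \<le> n" for x
      using Gle[of k x] h(2) by (cases "x \<in> {-(n+1)..n+1}") simp_all
    have "L2sq (\<lambda>x. (y x - h x) + (h x - G k x)) \<le> 2 * L2sq (\<lambda>x. y x - h x) + 2 * L2sq (\<lambda>x. h x - G k x)"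
      by (intro L2sq_add_le square_integrable_diff y h Gsq)
    then show "L2sq (\<lambda>x. y x - G k x) < e" using k h(6) by simp
  qed
qed

lemma moment_L2_initial:
  assumes a: "a > 0" and y: "square_integrable y"
  shows "((\<lambda>t. L2sq (\<lambda>x. moment a y 0 t x - y x)) \<longlongrightarrow> 0) (at_right 0)"
proof (rule order_tendstoI)
  fix e :: real assume e: "0 < e"
  obtain g C where g: "continuous_on UNIV g" "\<And>x. norm (g x) \<le> C" "integrable lebesgue g"
    "square_integrable g" "L2sq (\<lambda>x. y x - g x) < e / 12"
    using e by (rule_tac L2_dense_continuous[OF y, of "e / 12"]) auto
  have "\<forall>\<^sub>F t in at_right 0. L2sq (\<lambda>x. moment a g 0 t x - g x) < e / 12"
    using e by (intro order_tendstoD(2)[OF moment_L2_initial_bounded_continuous[OF a g(1-4)]]) auto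
  moreover have "\<forall>\<^sub>F t in at_right (0::real). 0 < t" by (simp add: eventually_at_filter)
  ultimately show "\<forall>\<^sub>F t in at_right 0. L2sq (\<lambda>x. moment a y 0 t x - y x) < e"
  proof eventually_elim
    case (elim t)
    note sm = square_integrable_moment[OF a _ elim(2)]
    have "moment a (\<lambda>s. y s - g s) 0 t = (\<lambda>x. moment a y 0 t x - moment a g 0 t x)"
      by (intro ext moment_diff a elim y g)
    then have 1: "L2sq (\<lambda>x. moment a y 0 t x - moment a g 0 t x) \<le> L2sq (\<lambda>x. y x - g x)"
      using L2sq_moment_le[OF a square_integrable_diff[OF y g(4)] elim(2)]
      by simp
    have 2: "L2sq (\<lambda>x. (moment a g 0 t x - g x) - (y x - g x))
        \<le> 2 * L2sq (\<lambda>x. moment a g 0 t x - g x) + 2 * L2sq (\<lambda>x. y x - g x)"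
      by (intro L2sq_diff_le square_integrable_diff sm y g)
    have "L2sq (\<lambda>x. (moment a y 0 t x - moment a g 0 t x) + ((moment a g 0 t x - g x) - (y x - g x)))
        \<le> 2 * L2sq (\<lambda>x. moment a y 0 t x - moment a g 0 t x)
          + 2 * L2sq (\<lambda>x. (moment a g 0 t x - g x) - (y x - g x))"
      by (intro L2sq_add_le square_integrable_diff sm y g)
    then have "L2sq (\<lambda>x. moment a y 0 t x - y x) \<le> 2 * L2sq (\<lambda>x. moment a y 0 t x - moment a g 0 t x)
          + 2 * L2sq (\<lambda>x. (moment a g 0 t x - g x) - (y x - g x))"
      by simp
    then show ?case using 1 2 elim(1) g(5) e by linarith
  qed
qed (auto intro!: always_eventually elim: less_le_trans[OF _ L2sq_nonneg])

section \<open>Existence and uniqueness\<close>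

lemma heat_solution_moment:
  assumes a: "a > 0" and y: "square_integrable y"
  shows "heat_solution a y (\<lambda>t x. if t = 0 then y x else moment a y 0 t x)"
proof -
  define u where "u t x = (if t = 0 then y x else moment a y 0 t x)" for t x
  have u0: "u 0 = y" by (simp add: u_def fun_eq_iff)
  have ut: "u t = moment a y 0 t" if "t > 0" for t
    using that by (simp add: u_def fun_eq_iff)
  note C12 = C12_heat_moment[OF a y, of u]
  have "L2_continuous u"
    unfolding L2_continuous_def L2sq_def[symmetric]
  proof (intro conjI allI impI)
    fix t :: real assume t: "0 \<le> t"
    show "square_integrable (u t)"
      using t y square_integrable_moment[OF a y, of t] by (cases "t = 0") (auto simp: u0 ut)
    show "((\<lambda>\<tau>. L2sq (\<lambda>x. u \<tau> x - u t x)) \<longlongrightarrow> 0) (at t within {0..})"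
    proof (cases "t = 0")
      case True
      have "at_right (0::real) = at 0 within {0..}"
        by (rule at_within_nhd[of _ UNIV]) auto
      then have "((\<lambda>\<tau>. L2sq (\<lambda>x. moment a y 0 \<tau> x - y x)) \<longlongrightarrow> 0) (at t within {0..})"
        using moment_L2_initial[OF a y] True by simp
      then show ?thesis
        by (rule Lim_transform_eventually) (auto simp: eventually_at_filter True u_def)
    next
      case False
      then have t: "t > 0" using t by simp
      have "\<forall>\<^sub>F \<tau> in at t within {0..}. 0 < \<tau>"
        using t by (intro order_tendstoD(1)[where y = t] tendsto_ident_at)
      then have "\<forall>\<^sub>F \<tau> in at t within {0..}.
          L2sq (\<lambda>x. moment a y 0 \<tau> x - moment a y 0 t x) = L2sq (\<lambda>x. u \<tau> x - u t x)"
        by eventually_elim (simp add: ut t)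
      then show ?thesis
        by (rule Lim_transform_eventually[OF moment_L2_continuous_at[OF a y t]])
    qed
  qed
  then show ?thesis
    unfolding heat_solution_def u_def[symmetric] using C12 by (auto simp: ut u0)
qed

theorem theorem5p1:
  fixes a :: real and y\<^sub>0 :: "real \<Rightarrow> complex"
  assumes "a > 0" and "square_integrable y\<^sub>0"
  shows "(\<forall>t>0. \<forall>x. integrable lebesgue (\<lambda>s. K a x s t *\<^sub>R y\<^sub>0 s)) \<and>
    heat_solution a y\<^sub>0
      (\<lambda>t x. if t = 0 then y\<^sub>0 x else \<integral>s. K a x s t *\<^sub>R y\<^sub>0 s \<partial>lebesgue) \<and>
    (\<forall>y. heat_solution a y\<^sub>0 y \<longrightarrow>
      (\<forall>t>0. \<forall>x. y t x = (\<integral>s. K a x s t *\<^sub>R y\<^sub>0 s \<partial>lebesgue)))"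
proof -
  have moment_0: "(\<integral>s. K a x s t *\<^sub>R y\<^sub>0 s \<partial>lebesgue) = moment a y\<^sub>0 0 t x" for t x
    by (simp add: moment_def)
  have "integrable lebesgue (\<lambda>s. K a x s t *\<^sub>R y\<^sub>0 s)" if "t > 0" for t x
    using integrable_moment[OF assms that, of 0 x] by simp
  moreover note heat_solution_moment[OF assms]
  moreover have "y t x = moment a y\<^sub>0 0 t x" if "heat_solution a y\<^sub>0 y" "t > 0" for y t x
    using heat_solution_unique[OF that(1) heat_solution_moment[OF assms] that(2), of x] that(2) by simp
  ultimately show ?thesis unfolding moment_0 by blast
qed

end
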